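(* Let $\mathcal{C}=(S,s_I,M,\Delta)$ be a channel machine and $s_F\in S$. Then $\mathcal{C}$ has an error-free computation from $(s_I,\varepsilon)$ to $(s_F,x)$ for some $x\in M^*$ if and only if there exist $n\in\mathbb{N}$ and a parameter valuation $v$ such that $L(\mathcal{C},n)\cap L_v(\mathcal{A}_\mathcal{C})\neq\emptyset$.
   Context: Channel machine: $\mathcal{C}=(S,s_I,M,\Delta)$ with finite control states $S$, initial $s_I$, finite messages $M$, $\Delta\subseteq S\times L\times S$, $L=\{m!,m?\mid m\in M\}\cup\{\varepsilon\}$. Configurations $(s,x)$, $x\in M^*$. Error-free steps: $(s,x)\xrightarrow{m!}(s',x\cdot m)$ if $(s,m!,s')\in\Delta$; $(s,m\cdot x')\xrightarrow{m?}(s',x')$ if $(s,m?,s')\in\Delta$; $(s,\varepsilon)\xrightarrow{\varepsilon}(s',\varepsilon)$ if $(s,\varepsilon,s')\in\Delta$. An error-free computation is a finite sequence of such steps. Timed words over $\Sigma$: nonempty finite sequences $(a_1,t_1)\dots(a_k,t_k)$, $t_i\in\mathbb{R}_{\ge0}$ nondecreasing; strictly monotonic if strictly increasing. $\Sigma=S\cup M\cup L\cup\{\#,\star\}$ (disjoint, $\#,\star$ fresh). For $n\in\mathbb{N}$, $L(\mathcal{C},n)$ is the set of timed words $w$ over $\Sigma$ such that: (1) $w$ strictly monotonic; (2) every occurrence of a control state $s\ne s_F$ at time $t$ is followed by some $l\in L$ at time $t+1$ and some $s'\in S$ at time $t+2$ with $(s,l,s')\in\Delta$, every occurrence of $s_F$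 at time $t$ is followed by $\star$ at time $t+1$, and symbols of $S\cup L\cup\{\star\}$ occur nowhere else; (3) symbols of $M\cup\{\#\}$ occur only between a control state and the next symbol of $L\cup\{\star\}$; (4) in each such segment every $\#$ occurs after all message symbols; (5) the untimed word begins with $s_I\#^nls$, $l\in L$, $s\in S$; (6) $w$ contains $s_F$; (7) for each infix $(s,t)(\sigma_1,t+d_1)\cdots(\sigma_r,t+d_r)(l,t+1)$ with $s\in S\setminus\{s_F\}$, $l\in L$, $\sigma_i\in M\cup\{\#\}$, $0<d_1<\dots<d_r<1$ (a "copy of $\sigma_i$" is an occurrence of $\sigma_i$ at time $t+2+d_i$): if $l=\varepsilon$, all $\sigma_i=\#$ and each has a copy; if $l=m!$ and some $\sigma_i=\#$ with $j$ least such, there is $m$ at time $t+2+d_j$ and each $\sigma_k$, $k\ne j$, has a copy; if $l=m!$ and no $\sigma_i=\#$, each $\sigma_i$ has a copy and there is an $m$ at a time strictly between $t+2+d_r$ and $t+3$; if $l=m?$ and $\sigma_1=m$, then $\sigma_i$ occurs at time $t+2+d_{i-1}$ for $i=2,\dots,r$ and $\#$ occurs at time $t+2+d_r$; if $l=m?$ and $\sigma_1\ne m$, each $\sigma_i$ has a copy and there is a $\#$ at a time strictly between $t+2+d_r$ and $t+3$. No other constraints. Parametric timed automata: locations, initial and final locations, one or more clocks, parameters, and edges $(l,a,\phi,\lambda,l')$ with letter $a$, clock constraint $\phi$ (conjunction of $x\sim c$, $c\in\mathbb{N}\cup\mathcal{P}$), reset set $\lambda$. A parameter valuation $v$ maps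 parameters to $\mathbb{Q}_{\ge0}$. $L_v(\mathcal{A})$ is the set of timed words $(a_1,t_1)\dots(a_k,t_k)$ for which there are edges $e_1,\dots,e_k$ forming a path from an initial to a final location, starting with all clocks $0$ at time $0$, such that, letting time elapse by $t_i-t_{i-1}$ ($t_0=0$) before taking $e_i$, the clock values (with parameters replaced by their $v$-values) satisfy the constraint of $e_i$ at that moment, $e_i$ carries letter $a_i$, and then the clocks in its reset set are set to $0$. $\mathcal{A}_\mathcal{C}$ is the parametric timed automaton over $\Sigma$ with one clock $x$, one parameter $p$, locations $1,\dots,5$, initial location $1$, final location $5$, and edges: $1\to2$ on $s_I$, no constraint, reset $x$; $2\to2$ on $\#$, guard $x=p$, reset $x$; $2\to3$ on each $l\in L$, guard $x=p$, no reset; $3\to3$ on each $a\in\Sigma\setminus\{s_F\}$, no constraint, no reset; $3\to4$ on $s_F$, no constraint, reset $x$; $4\to4$ on each $a\in M\cup\{\#\}$, guard $x=p$, reset $x$; $4\to5$ on $\star$, guard $x=p$, no reset.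
   Formalization: The formal theorem assumes s_F ≠ s_I: if s_F = s_I the empty computation reaches s_F but L(C,n) is empty for every n, so the claim fails. In (7), for an empty segment d_r is read as 0 and m? falls under σ_1 ≠ m. *)

theory Defs
  imports Complex_Main
begin

section \<open>Channel machines\<close>

datatype 'm action = Send 'm | Recv 'm | EpsAct

definition actions :: "'m set \<Rightarrow> 'm action set" where
  "actions M = Send ` M \<union> Recv ` M \<union> {EpsAct}"

record ('s, 'm) channel_machine =
  states :: "'s set"
  init_state :: 's
  messages :: "'m set"
  transitions :: "('s \<times> 'm action \<times> 's) set"

definition channel_machine :: "('s, 'm) channel_machine \<Rightarrow> bool" where
  "channel_machine C \<longleftrightarrow>
     finite (states C) \<and> init_state C \<in> states C \<and> finite (messages C) \<and>
     transitions C \<subseteq> states C \<times> actions (messages C) \<times> states C"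

text \<open>The \<open>EpsAct\<close> step tests the channel for emptiness.\<close>

inductive error_free_step ::
  "('s, 'm) channel_machine \<Rightarrow> 's \<times> 'm list \<Rightarrow> 'm action \<Rightarrow> 's \<times> 'm list \<Rightarrow> bool"
  for C where
  send: "(s, Send m, s') \<in> transitions C \<Longrightarrow> error_free_step C (s, x) (Send m) (s', x @ [m])"
| recv: "(s, Recv m, s') \<in> transitions C \<Longrightarrow> error_free_step C (s, m # x') (Recv m) (s', x')"
| eps:  "(s, EpsAct, s') \<in> transitions C \<Longrightarrow> error_free_step C (s, []) EpsAct (s', [])"

definition error_free_computation ::
  "('s, 'm) channel_machine \<Rightarrow> 's \<times> 'm list \<Rightarrow> 's \<times> 'm list \<Rightarrow> bool" where
  "error_free_computation C = (\<lambda>c c'. \<exists>a. error_free_step C c a c')\<^sup>*\<^sup>*"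


section \<open>Timed words\<close>

type_synonym 'a timed_word = "('a \<times> real) list"

definition timed_word :: "'a set \<Rightarrow> 'a timed_word \<Rightarrow> bool" where
  "timed_word A w \<longleftrightarrow> w \<noteq> [] \<and> fst ` set w \<subseteq> A \<and> (\<forall>t \<in> snd ` set w. 0 \<le> t) \<and> sorted (map snd w)"

definition strictly_monotonic :: "'a timed_word \<Rightarrow> bool" where
  "strictly_monotonic w \<longleftrightarrow> sorted_wrt (<) (map snd w)"


section \<open>Parametric timed automata\<close>

datatype comparison = Less | LessEq | Equal | GreaterEq | Greater

fun compare :: "comparison \<Rightarrow> real \<Rightarrow> real \<Rightarrow> bool" where
  "compare Less a b \<longleftrightarrow> a < b"
| "compare LessEq a b \<longleftrightarrow> a \<le> b"
| "compare Equal a b \<longleftrightarrow> a = b"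
| "compare GreaterEq a b \<longleftrightarrow> a \<ge> b"
| "compare Greater a b \<longleftrightarrow> a > b"

datatype 'p bound = Const nat | Param 'p

fun bound_value :: "('p \<Rightarrow> rat) \<Rightarrow> 'p bound \<Rightarrow> real" where
  "bound_value v (Const c) = real c"
| "bound_value v (Param p) = real_of_rat (v p)"

text \<open>A clock constraint is a finite conjunction, represented by the list of its conjuncts.\<close>

type_synonym ('x, 'p) clock_constraint = "('x \<times> comparison \<times> 'p bound) list"

definition satisfies ::
  "('p \<Rightarrow> rat) \<Rightarrow> ('x \<Rightarrow> real) \<Rightarrow> ('x, 'p) clock_constraint \<Rightarrow> bool" where
  "satisfies v \<nu> \<phi> \<longleftrightarrow> (\<forall>(x, c, b) \<in> set \<phi>. compare c (\<nu> x) (bound_value v b))"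

type_synonym ('l, 'a, 'x, 'p) edge = "'l \<times> 'a \<times> ('x, 'p) clock_constraint \<times> 'x set \<times> 'l"

record ('l, 'a, 'x, 'p) pta =
  locations :: "'l set"
  initial :: "'l set"
  final :: "'l set"
  clocks :: "'x set"
  params :: "'p set"
  edges :: "('l, 'a, 'x, 'p) edge set"

definition pta :: "'a set \<Rightarrow> ('l, 'a, 'x, 'p) pta \<Rightarrow> bool" where
  "pta A \<A> \<longleftrightarrow>
     finite (locations \<A>) \<and> initial \<A> \<subseteq> locations \<A> \<and> final \<A> \<subseteq> locations \<A> \<and>
     finite (clocks \<A>) \<and> clocks \<A> \<noteq> {} \<and> finite (params \<A>) \<and> finite (edges \<A>) \<and>
     (\<forall>(l, a, \<phi>, r, l') \<in> edges \<A>.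
        l \<in> locations \<A> \<and> a \<in> A \<and> r \<subseteq> clocks \<A> \<and> l' \<in> locations \<A> \<and>
        (\<forall>(x, c, b) \<in> set \<phi>. x \<in> clocks \<A> \<and> set_bound b \<subseteq> params \<A>))"

definition parameter_valuation :: "('l, 'a, 'x, 'p) pta \<Rightarrow> ('p \<Rightarrow> rat) \<Rightarrow> bool" where
  "parameter_valuation \<A> v \<longleftrightarrow> (\<forall>p \<in> params \<A>. 0 \<le> v p)"

text \<open>\<open>accepts_from \<A> v l \<nu> t w\<close>: from location \<open>l\<close> with clock values \<open>\<nu>\<close> at absolute
  time \<open>t\<close>, some path of edges reads \<open>w\<close> and ends in a final location.\<close>

fun accepts_from ::
  "('l, 'a, 'x, 'p) pta \<Rightarrow> ('p \<Rightarrow> rat) \<Rightarrow> 'l \<Rightarrow> ('x \<Rightarrow> real) \<Rightarrow> real \<Rightarrow> 'a timed_word \<Rightarrow> bool" where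
  "accepts_from \<A> v l \<nu> t [] \<longleftrightarrow> l \<in> final \<A>"
| "accepts_from \<A> v l \<nu> t ((a, t') # w) \<longleftrightarrow>
     (\<exists>\<phi> r l'. (l, a, \<phi>, r, l') \<in> edges \<A> \<and>
        satisfies v (\<lambda>x. \<nu> x + (t' - t)) \<phi> \<and>
        accepts_from \<A> v l' (\<lambda>x. if x \<in> r then 0 else \<nu> x + (t' - t)) t' w)"

definition pta_language ::
  "('p \<Rightarrow> rat) \<Rightarrow> ('l, 'a, 'x, 'p) pta \<Rightarrow> 'a timed_word set" where
  "pta_language v \<A> =
     {w. timed_word UNIV w \<and> (\<exists>l \<in> initial \<A>. accepts_from \<A> v l (\<lambda>_. 0) 0 w)}"


section \<open>Timed words encoding computations\<close>

datatype ('s, 'm) letter = State 's | Msg 'm | Act "'m action" | Hash | Star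

definition message_letters :: "('s, 'm) channel_machine \<Rightarrow> ('s, 'm) letter set" where
  "message_letters C = Msg ` messages C"

definition state_letters :: "('s, 'm) channel_machine \<Rightarrow> ('s, 'm) letter set" where
  "state_letters C = State ` states C"

definition action_letters :: "('s, 'm) channel_machine \<Rightarrow> ('s, 'm) letter set" where
  "action_letters C = Act ` actions (messages C)"

definition alphabet :: "('s, 'm) channel_machine \<Rightarrow> ('s, 'm) letter set" where
  "alphabet C = state_letters C \<union> message_letters C \<union> action_letters C \<union> {Hash, Star}"

text \<open>``Nowhere else'' in the last three conjuncts: a control state occurs either at the start of
  the word or as the successor of a control state two time units earlier; an action or \<open>Star\<close> only
  one time unit after the control state that requires it.\<close>

definition control_structure ::
  "('s, 'm) channel_machine \<Rightarrow> 's \<Rightarrow> ('s, 'm) letter timed_word \<Rightarrow> bool" where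
  "control_structure C s\<^sub>F w \<longleftrightarrow>
     (\<forall>s t. (State s, t) \<in> set w \<and> s \<noteq> s\<^sub>F \<longrightarrow>
        (\<exists>l s'. (s, l, s') \<in> transitions C \<and> (Act l, t + 1) \<in> set w \<and> (State s', t + 2) \<in> set w)) \<and>
     (\<forall>t. (State s\<^sub>F, t) \<in> set w \<longrightarrow> (Star, t + 1) \<in> set w) \<and>
     (\<forall>k s u. k < length w \<and> w ! k = (State s, u) \<longrightarrow>
        k = 0 \<or> (\<exists>s' t. (State s', t) \<in> set w \<and> s' \<noteq> s\<^sub>F \<and> u = t + 2)) \<and>
     (\<forall>l u. (Act l, u) \<in> set w \<longrightarrow> (\<exists>s t. (State s, t) \<in> set w \<and> s \<noteq> s\<^sub>F \<and> u = t + 1)) \<and>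
     (\<forall>u. (Star, u) \<in> set w \<longrightarrow> (\<exists>t. (State s\<^sub>F, t) \<in> set w \<and> u = t + 1))"

definition segment ::
  "('s, 'm) channel_machine \<Rightarrow> ('s, 'm) letter timed_word \<Rightarrow> nat \<Rightarrow> nat \<Rightarrow> bool" where
  "segment C w i j \<longleftrightarrow>
     i < j \<and> j < length w \<and> fst (w ! i) \<in> state_letters C \<and>
     fst (w ! j) \<in> action_letters C \<union> {Star} \<and>
     (\<forall>k. i < k \<and> k < j \<longrightarrow> fst (w ! k) \<notin> action_letters C \<union> {Star})"

definition content_in_segments ::
  "('s, 'm) channel_machine \<Rightarrow> ('s, 'm) letter timed_word \<Rightarrow> bool" where
  "content_in_segments C w \<longleftrightarrow>
     (\<forall>k < length w. fst (w ! k) \<in> message_letters C \<union> {Hash} \<longrightarrow>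
        (\<exists>i j. segment C w i j \<and> i < k \<and> k < j))"

definition hashes_after_messages ::
  "('s, 'm) channel_machine \<Rightarrow> ('s, 'm) letter timed_word \<Rightarrow> bool" where
  "hashes_after_messages C w \<longleftrightarrow>
     (\<forall>i j a b. segment C w i j \<and> i < a \<and> a < j \<and> i < b \<and> b < j \<and>
        fst (w ! a) = Hash \<and> fst (w ! b) \<in> message_letters C \<longrightarrow> b < a)"

text \<open>The copying constraint for a segment that starts at time \<open>t\<close>, contains the symbols \<open>\<sigma>\<close> at
  offsets \<open>d\<close>, and ends with action \<open>l\<close>. Lists are indexed from \<open>0\<close>. The offset of the last symbol
  is read as \<open>0\<close> if the segment is empty; an empty segment falls under the last case of both
  sending and receiving.\<close>

fun copying ::
  "('s, 'm) letter timed_word \<Rightarrow> real \<Rightarrow> ('s, 'm) letter list \<Rightarrow> real list \<Rightarrow> 'm action \<Rightarrow> bool" where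
  "copying w t \<sigma> d EpsAct \<longleftrightarrow>
     (\<forall>i < length \<sigma>. \<sigma> ! i = Hash \<and> (\<sigma> ! i, t + 2 + d ! i) \<in> set w)"
| "copying w t \<sigma> d (Send m) \<longleftrightarrow>
     (if Hash \<in> set \<sigma>
      then let j = (LEAST i. i < length \<sigma> \<and> \<sigma> ! i = Hash)
           in (Msg m, t + 2 + d ! j) \<in> set w \<and>
              (\<forall>k < length \<sigma>. k \<noteq> j \<longrightarrow> (\<sigma> ! k, t + 2 + d ! k) \<in> set w)
      else (\<forall>i < length \<sigma>. (\<sigma> ! i, t + 2 + d ! i) \<in> set w) \<and>
           (\<exists>u. t + 2 + last (0 # d) < u \<and> u < t + 3 \<and> (Msg m, u) \<in> set w))"
| "copying w t \<sigma> d (Recv m) \<longleftrightarrow>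
     (if \<sigma> \<noteq> [] \<and> \<sigma> ! 0 = Msg m
      then (\<forall>i. 1 \<le> i \<and> i < length \<sigma> \<longrightarrow> (\<sigma> ! i, t + 2 + d ! (i - 1)) \<in> set w) \<and>
           (Hash, t + 2 + last (0 # d)) \<in> set w
      else (\<forall>i < length \<sigma>. (\<sigma> ! i, t + 2 + d ! i) \<in> set w) \<and>
           (\<exists>u. t + 2 + last (0 # d) < u \<and> u < t + 3 \<and> (Hash, u) \<in> set w))"

definition content_copied ::
  "('s, 'm) channel_machine \<Rightarrow> 's \<Rightarrow> ('s, 'm) letter timed_word \<Rightarrow> bool" where
  "content_copied C s\<^sub>F w \<longleftrightarrow>
     (\<forall>pre post s t \<sigma> d l.
        w = pre @ [(State s, t)] @ zip \<sigma> (map (\<lambda>e. t + e) d) @ [(Act l, t + 1)] @ post \<and>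
        length \<sigma> = length d \<and> s \<in> states C - {s\<^sub>F} \<and> l \<in> actions (messages C) \<and>
        set \<sigma> \<subseteq> message_letters C \<union> {Hash} \<and> sorted_wrt (<) ([0] @ d @ [1]) \<longrightarrow>
        copying w t \<sigma> d l)"

definition encoding_language ::
  "('s, 'm) channel_machine \<Rightarrow> 's \<Rightarrow> nat \<Rightarrow> ('s, 'm) letter timed_word set" where
  "encoding_language C s\<^sub>F n =
     {w. timed_word (alphabet C) w \<and>
         strictly_monotonic w \<and>
         control_structure C s\<^sub>F w \<and>
         content_in_segments C w \<and>
         hashes_after_messages C w \<and>
         (\<exists>l \<in> actions (messages C). \<exists>s \<in> states C. \<exists>rest.
            map fst w = [State (init_state C)] @ replicate n Hash @ [Act l, State s] @ rest) \<and>
         State s\<^sub>F \<in> fst ` set w \<and>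
         content_copied C s\<^sub>F w}"

text \<open>If the target state is the initial state, then the leading control state is followed by
  \<open>Star\<close> rather than by an action, contradicting the required beginning of the word. So the
  encoding only makes sense for a target state different from the initial one.\<close>

lemma encoding_language_init_state_empty: "encoding_language C (init_state C) n = {}"
proof (rule equals0I)
  fix w assume "w \<in> encoding_language C (init_state C) n"
  then obtain l s rest where w: "map fst w = [State (init_state C)] @ replicate n Hash @ [Act l, State s] @ rest"
    and mono: "strictly_monotonic w" and cs: "control_structure C (init_state C) w"
    unfolding encoding_language_def by auto
  have len: "length w = length rest + n + 3"
    using arg_cong[OF w, of length] by simp
  have nth: "fst (w ! i) = (map fst w) ! i" if "i < length w" for i
    using that by simp
  have lt: "snd (w ! i) < snd (w ! j)" if "i < j" "j < length w" for i j
    using mono that unfolding strictly_monotonic_def sorted_wrt_map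
    by (auto simp: sorted_wrt_iff_nth_less)
  have "fst (w ! Suc n) = Act l"
    using len by (subst nth) (auto simp: w nth_append nth_Cons')
  moreover have "w ! Suc n \<in> set w"
    using len by simp
  ultimately have "(Act l, snd (w ! Suc n)) \<in> set w"
    by (metis prod.collapse)
  then obtain s' t where st: "(State s', t) \<in> set w" "s' \<noteq> init_state C" "snd (w ! Suc n) = t + 1"
    using cs unfolding control_structure_def by blast
  then obtain k where k: "k < length w" "w ! k = (State s', t)"
    by (auto simp: in_set_conv_nth)
  have "k < Suc n"
  proof (rule ccontr)
    assume "\<not> k < Suc n"
    then have "snd (w ! Suc n) \<le> snd (w ! k)"
      using lt[of "Suc n" k] k by (cases "k = Suc n") auto
    with k st show False by simp
  qed
  then have "fst (w ! k) \<in> {State (init_state C), Hash}"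
    using k by (subst nth) (auto simp: w nth_append nth_Cons')
  with k st show False by auto
qed


section \<open>The automaton\<close>

abbreviation clock_is_param :: "(unit, unit) clock_constraint" where
  "clock_is_param \<equiv> [((), Equal, Param ())]"

definition machine_automaton ::
  "('s, 'm) channel_machine \<Rightarrow> 's \<Rightarrow> (nat, ('s, 'm) letter, unit, unit) pta" where
  "machine_automaton C s\<^sub>F =
     \<lparr>locations = {1, 2, 3, 4, 5},
      initial = {1},
      final = {5},
      clocks = {()},
      params = {()},
      edges =
        {(1, State (init_state C), [], {()}, 2)}
        \<union> {(2, Hash, clock_is_param, {()}, 2)}
        \<union> {(2, a, clock_is_param, {}, 3) | a. a \<in> action_letters C}
        \<union> {(3, a, [], {}, 3) | a. a \<in> alphabet C - {State s\<^sub>F}}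
        \<union> {(3, State s\<^sub>F, [], {()}, 4)}
        \<union> {(4, a, clock_is_param, {()}, 4) | a. a \<in> message_letters C \<union> {Hash}}
        \<union> {(4, Star, clock_is_param, {}, 5)}\<rparr>"

lemma pta_machine_automaton:
  assumes "channel_machine C" and "s\<^sub>F \<in> states C"
  shows "pta (alphabet C) (machine_automaton C s\<^sub>F)"
proof -
  have "finite (alphabet C)" "finite (action_letters C)" "finite (message_letters C)"
    using assms by (auto simp: channel_machine_def alphabet_def action_letters_def
        message_letters_def state_letters_def actions_def)
  then have "finite (edges (machine_automaton C s\<^sub>F))"
    by (simp add: machine_automaton_def Setcompr_eq_image)
  with assms show ?thesis
    by (auto simp: pta_def machine_automaton_def channel_machine_def alphabet_def
        state_letters_def)
qed

end

theory Submission
  imports Defs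
begin

text \<open>An error-free computation whose channel contents have length at most \<open>n\<close> is encoded by writing
  each content, padded with \<open>#\<close> to exactly \<open>n\<close> symbols, at equidistant times in a unit interval;
  the automaton accepts this word with \<open>p = 1 / (n + 1)\<close>.

  Conversely, \<open>L(C, n)\<close> forbids losing symbols but not inserting them, so the number of symbols
  per unit interval never decreases along an encoding word. The automaton forces the first and the last
  interval to contain equally many symbols, namely \<open>1 / p - 1 = n\<close>. Hence nothing is inserted
  anywhere: every content is exactly the copy of its predecessor, and the word encodes an
  error-free computation.\<close>

section \<open>Encoding a computation\<close>

text \<open>The obstacle is that \<open>L(C, n)\<close> only says which letters must be present. Two
  faults are therefore conceivable: surplus letters in an interval, and transitions that the channel
  does not permit. Counting excludes both. A send overwrites the first \<open>#\<close>, a matching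
  receive shifts the content and refills its end with \<open>#\<close>, and the emptiness test
  demands that all symbols be \<open>#\<close>; these keep the number of symbols. A send without a
  free \<open>#\<close> and a receive whose message is not in front are exactly the cases where
  \<open>copying\<close> demands one further symbol behind all the copies, so they increase the
  number strictly. Equal numbers at both ends leave only legal steps.

  The automaton measures nothing but these two ends. There its guard and resets put consecutive
  letters at distance \<open>p\<close>, while the control structure puts the closing letter one time
  unit after the state; so \<open>n\<close> symbols in between mean \<open>(n + 1) * p = 1\<close>,
  which is the origin of the value \<open>1 / (n + 1)\<close>.\<close>

locale machine_run =
  fixes C :: "('s, 'm) channel_machine" and s\<^sub>F :: 's
    and s :: "nat \<Rightarrow> 's" and x :: "nat \<Rightarrow> 'm list" and l :: "nat \<Rightarrow> 'm action" and N n :: nat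
  assumes machine: "channel_machine C"
    and start: "s 0 = init_state C" "x 0 = []"
    and target: "s N = s\<^sub>F" "0 < N" "\<And>i. i < N \<Longrightarrow> s i \<noteq> s\<^sub>F"
    and step: "\<And>i. i < N \<Longrightarrow> error_free_step C (s i, x i) (l i) (s (Suc i), x (Suc i))"
    and capacity: "\<And>i. i \<le> N \<Longrightarrow> length (x i) \<le> n"
begin

lemma transition: "i < N \<Longrightarrow> (s i, l i, s (Suc i)) \<in> transitions C"
  using step[of i] by (auto elim: error_free_step.cases)

lemma transition_letters:
  assumes "i < N"
  shows "s i \<in> states C" "l i \<in> actions (messages C)" "s (Suc i) \<in> states C"
  using transition[OF assms] machine by (auto simp: channel_machine_def)

lemma state_in_states: "i \<le> N \<Longrightarrow> s i \<in> states C"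
  using transition_letters(1)[of i] transition_letters(3)[of "N - 1"] target(2)
  by (cases "i = N") auto

lemma channel_in_messages: "i \<le> N \<Longrightarrow> set (x i) \<subseteq> messages C"
proof (induction i)
  case 0
  then show ?case by (simp add: start)
next
  case (Suc i)
  then have "error_free_step C (s i, x i) (l i) (s (Suc i), x (Suc i))" "l i \<in> actions (messages C)"
    using step transition_letters(2) by auto
  then show ?case
    using Suc by (cases rule: error_free_step.cases) (auto simp: actions_def)
qed

text \<open>The word consists of \<open>N + 1\<close> blocks of \<open>n + 2\<close> letters. Letter \<open>j\<close> of block \<open>i\<close> has index
  \<open>i * (n + 2) + j\<close>; the content of the channel occupies the letters \<open>1, \<dots>, n\<close>.\<close>

definition cell :: "nat \<Rightarrow> nat \<Rightarrow> ('s, 'm) letter" where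
  "cell i j =
    (if j = 0 then State (s i)
     else if j \<le> length (x i) then Msg (x i ! (j - 1))
     else if j \<le> n then Hash
     else if i < N then Act (l i) else Star)"

text \<open>The step \<open>1 / (n + 1)\<close> is the value chosen for the parameter. Letter
  \<open>0\<close> falls on an even integer, letter \<open>n + 1\<close> exactly one unit later, and
  the content strictly between them; the unit before the next block stays empty.\<close>

definition tick :: "nat \<Rightarrow> nat \<Rightarrow> real" where
  "tick i j = 2 * real i + real j / (real n + 1)"

definition word :: "('s, 'm) letter timed_word" where
  "word = map (\<lambda>k. (cell (k div (n + 2)) (k mod (n + 2)), tick (k div (n + 2)) (k mod (n + 2))))
     [0..<(N + 1) * (n + 2)]"

lemma length_word [simp]: "length word = (N + 1) * (n + 2)"
  by (simp add: word_def)

lemma index_less: "i \<le> N \<Longrightarrow> j \<le> n + 1 \<Longrightarrow> i * (n + 2) + j < (N + 1) * (n + 2)"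
  using mult_le_mono1[of "i + 1" "N + 1" "n + 2"] by (simp add: algebra_simps)

lemma word_nth: "i \<le> N \<Longrightarrow> j \<le> n + 1 \<Longrightarrow> word ! (i * (n + 2) + j) = (cell i j, tick i j)"
  using index_less[of i j] by (simp add: word_def del: mult_Suc_right add_2_eq_Suc add_2_eq_Suc')

lemma indexE:
  assumes "k < (N + 1) * (n + 2)"
  obtains i j where "k = i * (n + 2) + j" "i \<le> N" "j \<le> n + 1"
proof
  show "k = (k div (n + 2)) * (n + 2) + k mod (n + 2)" by (rule div_mult_mod_eq[symmetric])
  show "k div (n + 2) \<le> N" using assms less_mult_imp_div_less[of k "N + 1" "n + 2"] by simp
  show "k mod (n + 2) \<le> n + 1" using mod_less_divisor[of "n + 2" k] by linarith
qed

text \<open>Positions stay below the base \<open>n + 2\<close>, so indices compare like two-digit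
  numbers with the block as leading digit.\<close>

lemma index_less_iff:
  assumes "j \<le> n + 1" "j' \<le> n + 1"
  shows "i * (n + 2) + j < i' * (n + 2) + j' \<longleftrightarrow> i < i' \<or> i = i' \<and> j < j'"
proof -
  have "a * (n + 2) + b < a' * (n + 2) + b'" if "a < a'" "b \<le> n + 1" for a a' b b' :: nat
    using mult_le_mono1[of "a + 1" a' "n + 2"] that by simp
  from this[of i i' j j'] this[of i' i j' j] assms show ?thesis
    by (cases i i' rule: linorder_cases) auto
qed

text \<open>Block \<open>i\<close> is over by time \<open>2 * i + 1\<close>, and a later block does
  not start before \<open>2 * i + 2\<close>.\<close>

lemma tick_less:
  assumes "j \<le> n + 1" "i < i' \<or> i = i' \<and> j < j'"
  shows "tick i j < tick i' j'"
proof -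
  have "real j / (real n + 1) \<le> 1" using assms(1) by simp
  moreover have "0 \<le> real j' / (real n + 1)" by simp
  moreover have "real j / (real n + 1) < real j' / (real n + 1)" if "j < j'"
    using that by (intro divide_strict_right_mono) auto
  moreover have "2 * real i + 2 \<le> 2 * real i'" if "i < i'" using that by linarith
  ultimately show ?thesis
    using assms(2) unfolding tick_def by (cases "i < i'") linarith+
qed

lemma tick_0: "tick i 0 = 2 * real i" and tick_end: "tick i (n + 1) = 2 * real i + 1"
  and tick_Suc: "tick (Suc i) j = tick i j + 2"
  by (simp_all add: tick_def add_ac)

lemma in_word_iff:
  "(a, u) \<in> set word \<longleftrightarrow> (\<exists>i j. i \<le> N \<and> j \<le> n + 1 \<and> a = cell i j \<and> u = tick i j)"
proof
  assume "(a, u) \<in> set word"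
  then obtain k where k: "k < (N + 1) * (n + 2)" "word ! k = (a, u)"
    by (metis in_set_conv_nth length_word)
  then show "\<exists>i j. i \<le> N \<and> j \<le> n + 1 \<and> a = cell i j \<and> u = tick i j"
    by (metis indexE word_nth prod.inject)
next
  assume "\<exists>i j. i \<le> N \<and> j \<le> n + 1 \<and> a = cell i j \<and> u = tick i j"
  then show "(a, u) \<in> set word"
    by (metis index_less length_word nth_mem word_nth)
qed

lemma cell_in_word: "i \<le> N \<Longrightarrow> j \<le> n + 1 \<Longrightarrow> (cell i j, tick i j) \<in> set word"
  by (auto simp: in_word_iff)

lemma cell_0 [simp]: "cell i 0 = State (s i)"
  by (simp add: cell_def)

lemma cell_Suc: "j < n \<Longrightarrow> cell i (Suc j) = (if j < length (x i) then Msg (x i ! j) else Hash)"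
  by (simp add: cell_def)

lemma cell_end: "i \<le> N \<Longrightarrow> cell i (n + 1) = (if i < N then Act (l i) else Star)"
  using capacity[of i] by (simp add: cell_def)

lemma cell_content:
  assumes "i \<le> N" "0 < j" "j \<le> n"
  shows "cell i j \<in> message_letters C \<union> {Hash}"
proof -
  have "x i ! (j - 1) \<in> messages C" if "j \<le> length (x i)"
    using channel_in_messages[OF assms(1)] that assms(2) nth_mem[of "j - 1" "x i"] by auto
  then show ?thesis using assms by (auto simp: cell_def message_letters_def)
qed

lemma cell_eq_State: "i \<le> N \<Longrightarrow> j \<le> n + 1 \<Longrightarrow> cell i j = State q \<longleftrightarrow> j = 0 \<and> q = s i"
  by (auto simp: cell_def)

lemma cell_eq_Act:
  "i \<le> N \<Longrightarrow> j \<le> n + 1 \<Longrightarrow> cell i j = Act a \<longleftrightarrow> j = n + 1 \<and> i < N \<and> a = l i"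
  using capacity[of i] by (auto simp: cell_def)

lemma cell_eq_Star: "i \<le> N \<Longrightarrow> j \<le> n + 1 \<Longrightarrow> cell i j = Star \<longleftrightarrow> j = n + 1 \<and> i = N"
  using capacity[of i] by (auto simp: cell_def)

lemma cell_in_alphabet:
  assumes "i \<le> N" "j \<le> n + 1"
  shows "cell i j \<in> alphabet C"
proof -
  consider "j = 0" | "0 < j" "j \<le> n" | "j = n + 1" using assms by linarith
  then show ?thesis
  proof cases
    case 1
    then show ?thesis using state_in_states assms(1) by (simp add: alphabet_def state_letters_def)
  next
    case 2
    then show ?thesis using cell_content[OF assms(1)] by (auto simp: alphabet_def)
  next
    case 3
    then show ?thesis using cell_end[OF assms(1)] transition_letters(2)
      by (auto simp: alphabet_def action_letters_def)
  qed
qed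

section \<open>Membership of the word in the encoding language\<close>

lemma strictly_monotonic_word: "strictly_monotonic word"
  unfolding strictly_monotonic_def sorted_wrt_map
  unfolding sorted_wrt_iff_nth_less
proof (intro allI impI)
  fix k k' assume k: "k < k'" "k' < length word"
  then have "k < (N + 1) * (n + 2)" "k' < (N + 1) * (n + 2)" by simp_all
  then obtain i j i' j' where *: "k = i * (n + 2) + j" "i \<le> N" "j \<le> n + 1"
    "k' = i' * (n + 2) + j'" "i' \<le> N" "j' \<le> n + 1" by (metis indexE)
  then have "i < i' \<or> i = i' \<and> j < j'" using k(1) index_less_iff by blast
  then show "snd (word ! k) < snd (word ! k')" using * word_nth tick_less by simp
qed

lemma timed_word_word: "timed_word (alphabet C) word"
proof -
  have "sorted (map snd word)"
    using strictly_monotonic_word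
    unfolding strictly_monotonic_def by (rule strict_sorted_imp_sorted)
  moreover have "word \<noteq> []" by (simp flip: length_0_conv)
  moreover have "a \<in> alphabet C \<and> 0 \<le> u" if "(a, u) \<in> set word" for a u
    using that cell_in_alphabet by (auto simp: in_word_iff tick_def)
  ultimately show ?thesis by (auto simp: timed_word_def)
qed

lemma control_structure_word: "control_structure C s\<^sub>F word"
  unfolding control_structure_def
proof (intro conjI allI impI)
  fix q t assume "(State q, t) \<in> set word \<and> q \<noteq> s\<^sub>F"
  then obtain i where i: "i \<le> N" "q = s i" "t = tick i 0" "i \<noteq> N"
    by (metis in_word_iff cell_eq_State target(1))
  then have "i < N" by simp
  moreover have "(cell i (n + 1), tick i (n + 1)) \<in> set word" "(cell (Suc i) 0, tick (Suc i) 0) \<in> set word"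
    using \<open>i < N\<close> by (intro cell_in_word; simp)+
  ultimately have "(Act (l i), t + 1) \<in> set word" "(State (s (Suc i)), t + 2) \<in> set word"
    using cell_end[OF i(1)] unfolding i(3) tick_Suc tick_0 tick_end by (simp_all add: add.commute)
  then show "\<exists>l s'. (q, l, s') \<in> transitions C \<and> (Act l, t + 1) \<in> set word \<and> (State s', t + 2) \<in> set word"
    using transition[OF \<open>i < N\<close>] i(2) by blast
next
  fix t assume "(State s\<^sub>F, t) \<in> set word"
  then obtain i where i: "i \<le> N" "s\<^sub>F = s i" "t = tick i 0" by (metis in_word_iff cell_eq_State)
  then have "i = N" using target(3)[of i] by fastforce
  then show "(Star, t + 1) \<in> set word"
    using cell_in_word[of N "n + 1"] i cell_end[of N] unfolding tick_0 tick_end by simp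
next
  fix k q u assume k: "k < length word \<and> word ! k = (State q, u)"
  then obtain i j where ij: "k = i * (n + 2) + j" "i \<le> N" "j \<le> n + 1" by (metis indexE length_word)
  then have *: "j = 0" "u = tick i 0" using k word_nth[of i j] cell_eq_State[of i j q] by auto
  show "k = 0 \<or> (\<exists>s' t. (State s', t) \<in> set word \<and> s' \<noteq> s\<^sub>F \<and> u = t + 2)"
  proof (cases i)
    case 0
    then show ?thesis using ij * by simp
  next
    case (Suc i')
    then show ?thesis using cell_in_word[of i' 0] target(3)[of i'] ij * tick_Suc[of i' 0] by auto
  qed
next
  fix a u assume "(Act a, u) \<in> set word"
  then obtain i where "i < N" "u = tick i (n + 1)" by (metis in_word_iff cell_eq_Act)
  then show "\<exists>s t. (State s, t) \<in> set word \<and> s \<noteq> s\<^sub>F \<and> u = t + 1"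
    using cell_in_word[of i 0] target(3)[of i] unfolding tick_end tick_0 by auto
next
  fix u assume "(Star, u) \<in> set word"
  then have "u = tick N (n + 1)" by (metis in_word_iff cell_eq_Star)
  then show "\<exists>t. (State s\<^sub>F, t) \<in> set word \<and> u = t + 1"
    using cell_in_word[of N 0] target(1) unfolding tick_end tick_0 by auto
qed

lemma end_letter_iff:
  "i \<le> N \<Longrightarrow> j \<le> n + 1 \<Longrightarrow> cell i j \<in> action_letters C \<union> {Star} \<longleftrightarrow> j = n + 1"
  using cell_eq_Act[of i j] cell_eq_Star[of i j] transition_letters(2)[of i] cell_end[of i]
  by (auto simp: action_letters_def)

text \<open>A segment cannot run across an action or \<open>Star\<close>, and every block ends with
  one of these; so a segment that starts at the state of a block must stop at the end of the same
  block.\<close>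

lemma segment_word_iff:
  "segment C word a b \<longleftrightarrow> (\<exists>i\<le>N. a = i * (n + 2) \<and> b = i * (n + 2) + (n + 1))"
proof
  assume seg: "segment C word a b"
  then have ab: "a < b" "b < (N + 1) * (n + 2)" "a < (N + 1) * (n + 2)"
    by (auto simp: segment_def)
  then obtain i j i' j' where ij: "a = i * (n + 2) + j" "i \<le> N" "j \<le> n + 1"
    "b = i' * (n + 2) + j'" "i' \<le> N" "j' \<le> n + 1" by (metis indexE)
  have "cell i j \<in> state_letters C" using seg ij word_nth[of i j] by (auto simp: segment_def)
  then have j: "j = 0" using ij cell_eq_State by (auto simp: state_letters_def)
  have "cell i' j' \<in> action_letters C \<union> {Star}"
    using seg ij word_nth[of i' j'] by (auto simp: segment_def)
  then have j': "j' = n + 1" using ij end_letter_iff by blast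
  have "\<not> i * (n + 2) + (n + 1) < b"
  proof
    assume "i * (n + 2) + (n + 1) < b"
    moreover have "a < i * (n + 2) + (n + 1)" unfolding ij j by linarith
    ultimately have "fst (word ! (i * (n + 2) + (n + 1))) \<notin> action_letters C \<union> {Star}"
      using seg unfolding segment_def by blast
    then show False using ij word_nth[of i "n + 1"] end_letter_iff[of i "n + 1"] by simp
  qed
  moreover have "i \<le> i'" using ab(1) ij index_less_iff[of j j' i i'] by auto
  ultimately have "i = i'" using ij j' index_less_iff[of "n + 1" "n + 1" i i'] by auto
  then show "\<exists>i\<le>N. a = i * (n + 2) \<and> b = i * (n + 2) + (n + 1)" using ij j j' by auto
next
  assume "\<exists>i\<le>N. a = i * (n + 2) \<and> b = i * (n + 2) + (n + 1)"
  then obtain i where i: "i \<le> N" "a = i * (n + 2) + 0" "b = i * (n + 2) + (n + 1)" by auto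
  have "fst (word ! k) \<notin> action_letters C \<union> {Star}" if "a < k" "k < b" for k
  proof -
    define j where "j = k - a"
    have "k = i * (n + 2) + j" "j \<le> n" using that i unfolding j_def by auto
    then show ?thesis using word_nth[of i j] end_letter_iff[of i j] i by simp
  qed
  moreover have "fst (word ! a) \<in> state_letters C"
    using word_nth[of i 0] i state_in_states by (simp add: state_letters_def)
  moreover have "fst (word ! b) \<in> action_letters C \<union> {Star}"
    using word_nth[of i "n + 1"] end_letter_iff[of i "n + 1"] i by simp
  moreover have "a < b" "b < length word"
    using i index_less[of i "n + 1"] by simp_all
  ultimately show "segment C word a b" unfolding segment_def by blast
qed

lemma content_in_segments_word: "content_in_segments C word"
  unfolding content_in_segments_def
proof (intro allI impI)
  fix k assume k: "k < length word" "fst (word ! k) \<in> message_letters C \<union> {Hash}"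
  then obtain i j where ij: "k = i * (n + 2) + j" "i \<le> N" "j \<le> n + 1" by (metis indexE length_word)
  then have "cell i j \<in> message_letters C \<union> {Hash}" using k word_nth by auto
  moreover have "cell i 0 \<notin> message_letters C \<union> {Hash}" "cell i (n + 1) \<notin> message_letters C \<union> {Hash}"
    using cell_end[OF ij(2)] by (auto simp: message_letters_def)
  ultimately have "j \<noteq> 0" "j \<noteq> n + 1" by metis+
  then show "\<exists>a b. segment C word a b \<and> a < k \<and> k < b"
    unfolding segment_word_iff using ij
    by (intro exI[where x = "i * (n + 2)"] exI[where x = "i * (n + 2) + (n + 1)"] conjI exI[where x = i]) linarith+
qed

lemma hashes_after_messages_word: "hashes_after_messages C word"
  unfolding hashes_after_messages_def
proof (intro allI impI, elim conjE)
  fix a b p q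
  assume "segment C word a b" and pq: "a < p" "p < b" "a < q" "q < b"
    "fst (word ! p) = Hash" "fst (word ! q) \<in> message_letters C"
  then obtain i where i: "i \<le> N" "a = i * (n + 2)" "b = i * (n + 2) + (n + 1)"
    unfolding segment_word_iff by blast
  define j j' where "j = p - a" and "j' = q - a"
  have j: "p = i * (n + 2) + j" "0 < j" "j \<le> n" and j': "q = i * (n + 2) + j'" "0 < j'" "j' \<le> n"
    using pq i unfolding j_def j'_def by auto
  have "cell i j = Hash" "cell i j' \<in> message_letters C"
    using pq j j' word_nth[of i j] word_nth[of i j'] i by auto
  then have "length (x i) < j" "j' \<le> length (x i)"
    using j j' by (auto simp: cell_def message_letters_def split: if_splits)
  then show "q < p" using j j' by simp
qed

text \<open>Positions and times determine the quantified factorization: the state opens a block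
  \<open>i\<close>, the action closes the same block, and \<open>\<sigma>\<close> is its full
  content. Each kind of step then falls under a case of \<open>copying\<close> that adds no symbol,
  and a copy is the cell with the same position in block \<open>i + 1\<close>.\<close>

lemma content_copied_word: "content_copied C s\<^sub>F word"
  unfolding content_copied_def
proof (intro allI impI, elim conjE)
  fix pre post q t \<sigma> d a
  assume w: "word = pre @ [(State q, t)] @ zip \<sigma> (map (\<lambda>e. t + e) d) @ [(Act a, t + 1)] @ post"
    and len: "length \<sigma> = length d"
  have "(State q, t) \<in> set word" "(Act a, t + 1) \<in> set word" using w by auto
  define k where "k = length pre"
  have k: "word ! k = (State q, t)" "k < length word"
    unfolding k_def w by (auto simp: nth_append)
  have k': "word ! (k + 1 + length \<sigma>) = (Act a, t + 1)" "k + 1 + length \<sigma> < length word"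
    unfolding k_def w using len by (auto simp: nth_append)
  obtain i j where ij: "k = i * (n + 2) + j" "i \<le> N" "j \<le> n + 1" using k(2) by (metis indexE length_word)
  then have "cell i j = State q" "t = tick i j" using k word_nth[of i j] by auto
  then have j: "j = 0" "q = s i" "t = tick i 0" using cell_eq_State ij by auto
  obtain i' j' where ij': "k + 1 + length \<sigma> = i' * (n + 2) + j'" "i' \<le> N" "j' \<le> n + 1"
    using k'(2) by (metis indexE length_word)
  then have j': "j' = n + 1" "a = l i'" "t + 1 = tick i' j'" "i' < N"
    using k' word_nth[of i' j'] cell_eq_Act[of i' j' a] by auto
  \<comment> \<open>The action closes block \<open>i'\<close>, hence occurs at
    \<open>2 * i' + 1\<close>; it is also required at \<open>2 * i + 1\<close>.\<close>
  have i': "i' = i" using j(3) j'(1,3) unfolding j'(1) tick_0 tick_end by simp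
  have i: "i < N" using i' j' by simp
  have n: "length \<sigma> = n" using ij ij' j j' i' by simp
  have el: "\<sigma> ! r = cell i (Suc r)" "t + d ! r = tick i (Suc r)" if "r < n" for r
  proof -
    have "word ! (k + 1 + r) = (\<sigma> ! r, t + d ! r)"
      unfolding k_def w using len n that by (auto simp: nth_append)
    moreover have "k + 1 + r = i * (n + 2) + Suc r" using ij j by simp
    ultimately have "(\<sigma> ! r, t + d ! r) = (cell i (Suc r), tick i (Suc r))"
      using word_nth[of i "Suc r"] that i by simp
    then show "\<sigma> ! r = cell i (Suc r)" "t + d ! r = tick i (Suc r)" by auto
  qed
  have time: "t + 2 + d ! r = tick (Suc i) (Suc r)" if "r < n" for r
    using el(2)[OF that] tick_Suc[of i "Suc r"] by simp
  have mem: "(b, t + 2 + d ! r) \<in> set word" if "r < n" "b = cell (Suc i) (Suc r)" for r b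
    using time[OF that(1)] cell_in_word[of "Suc i" "Suc r"] that i by simp
  have cap: "length (x i) \<le> n" "length (x (Suc i)) \<le> n" using capacity i by auto
  show "copying word t \<sigma> d a"
    using step[OF i]
  proof (cases rule: error_free_step.cases)
    case (send m)
    \<comment> \<open>The content after the send is one longer and still within the capacity, so a
      \<open>Hash\<close> is free to be overwritten.\<close>
    have *: "length (x i) < n" using cap send by simp
    then have "\<sigma> ! length (x i) = Hash" using el(1) cell_Suc by simp
    then have "Hash \<in> set \<sigma>" using * n by (metis nth_mem)
    moreover have "(LEAST r. r < length \<sigma> \<and> \<sigma> ! r = Hash) = length (x i)"
      using * n el(1) cell_Suc by (intro Least_equality) (auto simp: not_less[symmetric])
    moreover have "(Msg m, t + 2 + d ! length (x i)) \<in> set word"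
      using send(2) * by (intro mem) (simp_all add: cell_Suc)
    moreover have "(\<sigma> ! k, t + 2 + d ! k) \<in> set word" if "k < n" "k \<noteq> length (x i)" for k
      using send(2) el(1) that by (intro mem) (simp_all add: cell_Suc nth_append)
    ultimately show ?thesis using n unfolding j'(2) i' send(1) copying.simps Let_def by simp
  next
    case (recv m)
    have pos: "0 < n" using cap recv by auto
    then have "\<sigma> \<noteq> [] \<and> \<sigma> ! 0 = Msg m" using n el(1)[of 0] cell_Suc[of 0] recv by auto
    moreover have "last (0 # d) = d ! (n - 1)" using pos len n by (auto simp: last_conv_nth)
    \<comment> \<open>The content after the receive is shorter than \<open>n\<close>, so the last
      content cell of the next block is padding.\<close>
    moreover have "(Hash, t + 2 + d ! (n - 1)) \<in> set word"
      using recv(1) pos cap by (intro mem) (simp_all add: cell_def)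
    moreover have "(\<sigma> ! k, t + 2 + d ! (k - 1)) \<in> set word" if "1 \<le> k" "k < n" for k
      using recv(1) el(1) that by (intro mem) (auto simp: cell_def)
    ultimately show ?thesis using n unfolding j'(2) i' recv(2) copying.simps by simp
  next
    case eps
    have "\<sigma> ! k = Hash" "(Hash, t + 2 + d ! k) \<in> set word" if "k < n" for k
      using eps el(1) that by (simp add: cell_Suc, intro mem) (simp_all add: cell_Suc)
    then show ?thesis using n unfolding j'(2) i' eps(2) copying.simps by simp
  qed
qed

lemma word_in_encoding_language: "word \<in> encoding_language C s\<^sub>F n"
proof -
  have nth: "map fst word ! (i * (n + 2) + j) = cell i j" if "i \<le> N" "j \<le> n + 1" for i j
    using that word_nth[of i j] index_less[of i j] by simp
  have len: "n + 3 \<le> length (map fst word)"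
    using index_less[of 1 0] mult_le_mono1[of 1 N "n + 2"] target(2) by simp
  \<comment> \<open>Block \<open>0\<close> has \<open>n + 2\<close> letters and, since the channel
    starts empty, only padding as content; the remaining letter is the state of block
    \<open>1\<close>, which exists because \<open>0 < N\<close>.\<close>
  have "take (n + 3) (map fst word) = [State (init_state C)] @ replicate n Hash @ [Act (l 0), State (s 1)]"
  proof (rule nth_equalityI)
    fix k assume "k < length (take (n + 3) (map fst word))"
    then have "k < n + 3" by simp
    then consider "k = 0" | j where "k = Suc j" "j < n" | "k = n + 1" | "k = n + 2"
      by (cases k) (auto, linarith)
    then have "map fst word ! k = ([State (init_state C)] @ replicate n Hash @ [Act (l 0), State (s 1)]) ! k"
    proof cases
      case 1
      then show ?thesis using nth[of 0 0] start by simp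
    next
      case 2
      then show ?thesis using nth[of 0 k] cell_Suc[of j 0] start by (simp add: nth_append)
    next
      case 3
      then show ?thesis using nth[of 0 k] cell_end[of 0] target(2) by (simp add: nth_append)
    next
      case 4
      then show ?thesis using nth[of 1 0] target(2) by (simp add: nth_append nth_Cons')
    qed
    with \<open>k < n + 3\<close> show "take (n + 3) (map fst word) ! k = ([State (init_state C)] @ replicate n Hash @ [Act (l 0), State (s 1)]) ! k"
      by simp
  qed (use len in simp)
  then have "map fst word = [State (init_state C)] @ replicate n Hash @ [Act (l 0), State (s 1)] @ drop (n + 3) (map fst word)"
    by (metis append.assoc append_take_drop_id)
  moreover have "l 0 \<in> actions (messages C)" "s 1 \<in> states C"
    using transition_letters[of 0] target(2) by auto
  moreover have "State s\<^sub>F \<in> fst ` set word" using cell_in_word[of N 0] target(1) by force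
  ultimately show ?thesis
    unfolding encoding_language_def mem_Collect_eq
    by (intro conjI timed_word_word strictly_monotonic_word control_structure_word content_in_segments_word
      hashes_after_messages_word content_copied_word bexI[of _ "l 0"] bexI[of _ "s 1"] exI[of _ "drop (n + 3) (map fst word)"])
qed

section \<open>Acceptance of the word by the automaton\<close>

lemma accepts_from_nth:
  assumes "k < length word" "word ! k = (a, t')"
    and "(q, a, \<phi>, r, q') \<in> edges \<A>" "satisfies v (\<lambda>c. \<nu> c + (t' - t)) \<phi>"
    and "accepts_from \<A> v q' (\<lambda>c. if c \<in> r then 0 else \<nu> c + (t' - t)) t' (drop (Suc k) word)"
  shows "accepts_from \<A> v q \<nu> t (drop k word)"
  using assms by (auto simp flip: Cons_nth_drop_Suc)

lemma word_in_pta_language: "word \<in> pta_language (\<lambda>_. 1 / of_nat (n + 1)) (machine_automaton C s\<^sub>F)"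
proof -
  let ?v = "\<lambda>_ :: unit. 1 / of_nat (n + 1) :: rat" and ?A = "machine_automaton C s\<^sub>F"
  have sat: "satisfies ?v (\<lambda>c. 0 + (tick i (Suc j) - tick i j)) clock_is_param" for i j
    by (simp add: satisfies_def tick_def of_rat_divide of_rat_add add_divide_distrib)
  \<comment> \<open>The run is built backwards, since \<open>inc_induct\<close> descends from the
    last position. The invariant describes the moment just after letter \<open>j\<close> of block
    \<open>N\<close> was read and the clock was reset.\<close>
  have loc4: "accepts_from ?A ?v 4 (\<lambda>_. 0) (tick N j) (drop (N * (n + 2) + Suc j) word)"
    if "j \<le> n" for j
    using that
  proof (induction j rule: inc_induct)
    case base
    show ?case
    proof (rule accepts_from_nth)
      show "N * (n + 2) + Suc n < length word" using index_less[of N "n + 1"] by simp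
      show "word ! (N * (n + 2) + Suc n) = (Star, tick N (Suc n))"
        using word_nth[of N "n + 1"] cell_end[of N] by simp
      show "(4, Star, clock_is_param, {}, 5) \<in> edges ?A" by (simp add: machine_automaton_def)
      show "accepts_from ?A ?v 5 \<nu> t (drop (Suc (N * (n + 2) + Suc n)) word)" for \<nu> t
        by (simp add: machine_automaton_def)
    qed (rule sat)
  next
    case (step j)
    show ?case
    proof (rule accepts_from_nth)
      show "N * (n + 2) + Suc j < length word" using index_less[of N "Suc j"] step by simp
      show "word ! (N * (n + 2) + Suc j) = (cell N (Suc j), tick N (Suc j))"
        using word_nth[of N "Suc j"] step by simp
      show "(4, cell N (Suc j), clock_is_param, {()}, 4) \<in> edges ?A"
        using cell_content[of N "Suc j"] step by (simp add: machine_automaton_def)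
      show "accepts_from ?A ?v 4 (\<lambda>c. if c \<in> {()} then 0 else 0 + (tick N (Suc j) - tick N j))
          (tick N (Suc j)) (drop (Suc (N * (n + 2) + Suc j)) word)"
        using step.IH by simp
    qed (rule sat)
  qed
  \<comment> \<open>Clock value and current time stay arbitrary because no edge leaving location
    \<open>3\<close> has a guard. The index \<open>N * (n + 2)\<close> is that of the letter
    \<open>s\<^sub>F\<close>.\<close>
  have loc3: "accepts_from ?A ?v 3 \<nu> t (drop k word)" if "k \<le> N * (n + 2)" for k \<nu> t
    using that
  proof (induction k arbitrary: \<nu> t rule: inc_induct)
    case base
    show ?case
    proof (rule accepts_from_nth)
      show "N * (n + 2) < length word" using index_less[of N 0] by simp
      show "word ! (N * (n + 2)) = (State s\<^sub>F, tick N 0)" using word_nth[of N 0] target(1) by simp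
      show "(3, State s\<^sub>F, [], {()}, 4) \<in> edges ?A" by (simp add: machine_automaton_def)
      show "accepts_from ?A ?v 4 (\<lambda>c. if c \<in> {()} then 0 else \<nu> c + (tick N 0 - t))
          (tick N 0) (drop (Suc (N * (n + 2))) word)"
        using loc4[of 0] by simp
    qed (simp add: satisfies_def)
  next
    case (step k)
    then have "k < (N + 1) * (n + 2)" using index_less[of N 0] by linarith
    then obtain i j where ij: "k = i * (n + 2) + j" "i \<le> N" "j \<le> n + 1" by (metis indexE)
    then have "i < N" using step(2) index_less_iff[of j 0 i N] by simp
    then have "cell i j \<in> alphabet C - {State s\<^sub>F}"
      using ij cell_in_alphabet cell_eq_State target(3)[OF \<open>i < N\<close>] by auto
    then have "(3, cell i j, [], {}, 3) \<in> edges ?A" by (simp add: machine_automaton_def)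
    then show ?case
    proof (rule accepts_from_nth[rotated 2])
      show "k < length word" using \<open>k < (N + 1) * (n + 2)\<close> by simp
      show "word ! k = (cell i j, tick i j)" unfolding ij(1) using ij by (intro word_nth)
    qed (use step.IH in \<open>simp_all add: satisfies_def\<close>)
  qed
  have loc2: "accepts_from ?A ?v 2 (\<lambda>_. 0) (tick 0 j) (drop (Suc j) word)" if "j \<le> n" for j
    using that
  proof (induction j rule: inc_induct)
    case base
    \<comment> \<open>Location \<open>3\<close> takes over at index \<open>n + 2\<close>, the state
      of block \<open>1\<close>; this is not yet past the letter \<open>s\<^sub>F\<close>.\<close>
    have "n + 2 \<le> N * (n + 2)" using target(2) by (cases N) auto
    have "Act (l 0) \<in> action_letters C"
      using transition_letters(2)[of 0] target(2) by (simp add: action_letters_def)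
    show ?case
    proof (rule accepts_from_nth)
      show "Suc n < length word" by simp
      show "word ! Suc n = (Act (l 0), tick 0 (Suc n))"
        using word_nth[of 0 "n + 1"] cell_end[of 0] target(2) by simp
      show "(2, Act (l 0), clock_is_param, {}, 3) \<in> edges ?A"
        using \<open>Act (l 0) \<in> action_letters C\<close> by (simp add: machine_automaton_def)
      show "accepts_from ?A ?v 3 \<nu> t (drop (Suc (Suc n)) word)" for \<nu> t
        using loc3[of "n + 2"] \<open>n + 2 \<le> N * (n + 2)\<close> by simp
    qed (rule sat)
  next
    case (step j)
    show ?case
    proof (rule accepts_from_nth)
      show "Suc j < length word" using step by simp
      show "word ! Suc j = (Hash, tick 0 (Suc j))"
        using word_nth[of 0 "Suc j"] cell_Suc[of j 0] start step by simp
      show "(2, Hash, clock_is_param, {()}, 2) \<in> edges ?A" by (simp add: machine_automaton_def)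
      show "accepts_from ?A ?v 2 (\<lambda>c. if c \<in> {()} then 0 else 0 + (tick 0 (Suc j) - tick 0 j))
          (tick 0 (Suc j)) (drop (Suc (Suc j)) word)"
        using step.IH by simp
    qed (rule sat)
  qed
  have "accepts_from ?A ?v 1 (\<lambda>_. 0) 0 (drop 0 word)"
  proof (rule accepts_from_nth)
    show "0 < length word" by simp
    show "word ! 0 = (State (init_state C), tick 0 0)" using word_nth[of 0 0] start by simp
    show "(1, State (init_state C), [], {()}, 2) \<in> edges ?A" by (simp add: machine_automaton_def)
    show "accepts_from ?A ?v 2 (\<lambda>c. if c \<in> {()} then 0 else 0 + (tick 0 0 - 0)) (tick 0 0) (drop (Suc 0) word)"
      using loc2[of 0] by simp
  qed (simp add: satisfies_def)
  then show ?thesis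
    using timed_word_word by (auto simp: pta_language_def timed_word_def machine_automaton_def)
qed

end

section \<open>From a computation to an accepted encoding\<close>

lemma computation_imp_encoding:
  assumes "channel_machine C" "s\<^sub>F \<noteq> init_state C"
    and "error_free_computation C (init_state C, []) (s\<^sub>F, x)"
  shows "\<exists>n v. parameter_valuation (machine_automaton C s\<^sub>F) v \<and>
    encoding_language C s\<^sub>F n \<inter> pta_language v (machine_automaton C s\<^sub>F) \<noteq> {}"
proof -
  obtain K where "((\<lambda>c c'. \<exists>a. error_free_step C c a c') ^^ K) (init_state C, []) (s\<^sub>F, x)"
    using assms(3) unfolding error_free_computation_def rtranclp_power by blast
  then obtain f where f: "f 0 = (init_state C, [])" "f K = (s\<^sub>F, x)"
    and "\<forall>i<K. \<exists>a. error_free_step C (f i) a (f (Suc i))"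
    unfolding relpowp_fun_conv by blast
  then obtain l where l: "\<And>i. i < K \<Longrightarrow> error_free_step C (f i) (l i) (f (Suc i))"
    by metis
  \<comment> \<open>The computation is cut at its first visit to \<open>s\<^sub>F\<close>, because
    the control structure admits no state two units after \<open>s\<^sub>F\<close>.\<close>
  define N where "N = (LEAST i. fst (f i) = s\<^sub>F)"
  have N: "fst (f N) = s\<^sub>F" unfolding N_def by (rule LeastI[of _ K]) (simp add: f)
  have "N \<le> K" unfolding N_def by (rule Least_le) (simp add: f)
  have N_min: "fst (f i) \<noteq> s\<^sub>F" if "i < N" for i using that not_less_Least unfolding N_def by blast
  \<comment> \<open>Any common bound on the lengths of the contents would serve.\<close>
  define n where "n = (\<Sum>i\<le>N. length (snd (f i)))"
  interpret machine_run C s\<^sub>F "fst \<circ> f" "snd \<circ> f" l N n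
  proof
    show "0 < N" using N f(1) assms(2) by (cases N) auto
    show "length ((snd \<circ> f) i) \<le> n" if "i \<le> N" for i
      unfolding n_def using that by (auto intro: member_le_sum[of i "{..N}" "\<lambda>i. length (snd (f i))", simplified])
  qed (use assms(1) f N N_min l \<open>N \<le> K\<close> in auto)
  have "parameter_valuation (machine_automaton C s\<^sub>F) (\<lambda>_. 1 / of_nat (n + 1))"
    by (simp add: parameter_valuation_def)
  then show ?thesis
    using word_in_encoding_language word_in_pta_language by blast
qed

section \<open>Strictly monotonic words\<close>

text \<open>The interval is open so that, for the time \<open>T\<close> of a state, neither the
  state nor the letter closing its segment at \<open>T + 1\<close> is counted.\<close>

definition window :: "'a timed_word \<Rightarrow> real \<Rightarrow> 'a timed_word" where
  "window w T = filter (\<lambda>y. T < snd y \<and> snd y < T + 1) w"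

lemma in_window_iff: "y \<in> set (window w T) \<longleftrightarrow> y \<in> set w \<and> T < snd y \<and> snd y < T + 1"
  by (auto simp: window_def)

lemma strictly_monotonic_append:
  "strictly_monotonic (xs @ ys) \<longleftrightarrow> strictly_monotonic xs \<and> strictly_monotonic ys \<and>
    (\<forall>y\<in>set xs. \<forall>z\<in>set ys. snd y < snd z)"
  by (auto simp: strictly_monotonic_def sorted_wrt_append)

lemma strictly_monotonic_Cons:
  "strictly_monotonic (y # ys) \<longleftrightarrow> strictly_monotonic ys \<and> (\<forall>z\<in>set ys. snd y < snd z)"
  by (auto simp: strictly_monotonic_def)

lemma strictly_monotonic_window: "strictly_monotonic w \<Longrightarrow> strictly_monotonic (window w T)"
  unfolding strictly_monotonic_def window_def sorted_wrt_map by (rule sorted_wrt_filter)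

lemma strictly_monotonic_distinct: "strictly_monotonic w \<Longrightarrow> distinct w"
  by (induction w) (auto simp: strictly_monotonic_def)

lemma strictly_monotonic_letter_unique:
  "strictly_monotonic w \<Longrightarrow> (a, t) \<in> set w \<Longrightarrow> (b, t) \<in> set w \<Longrightarrow> a = b"
  by (induction w) (auto simp: strictly_monotonic_def)

text \<open>Distinctness turns equal lengths into equal sets, and a set has only one strictly
  increasing enumeration. This is how equal symbol counts become exact copying: the required copies
  fill the whole next window.\<close>

lemma strictly_monotonic_eqI:
  assumes "strictly_monotonic xs" "strictly_monotonic ys" "set xs \<subseteq> set ys" "length xs = length ys"
  shows "xs = ys"
proof -
  have "set xs = set ys"
    using assms strictly_monotonic_distinct
    by (metis card_subset_eq distinct_card finite_set)
  then show ?thesis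
    using assms(1,2)
  proof (induction xs arbitrary: ys)
    case (Cons y xs)
    then obtain z zs where ys: "ys = z # zs" by (cases ys) auto
    then have "y \<in> set (z # zs)" "z \<in> set (y # xs)" using Cons.prems(1) by (metis list.set_intros(1))+
    \<comment> \<open>Each of the two is earliest in its own list and occurs in the other list, so
      neither can precede the other.\<close>
    then have "y = z"
      using Cons.prems(2,3) ys by (auto simp: strictly_monotonic_Cons dest: less_asym)
    moreover have "y \<notin> set xs" "z \<notin> set zs"
      using Cons.prems ys by (auto simp: strictly_monotonic_Cons)
    ultimately have "set xs = set zs" using Cons.prems ys by auto
    then show ?case using Cons ys \<open>y = z\<close> by (simp add: strictly_monotonic_Cons)
  qed simp
qed

text \<open>Brings a segment into the factorized form over which \<open>content_copied\<close>
  quantifies.\<close>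

lemma window_decomposition:
  assumes "strictly_monotonic w" "(a, T) \<in> set w" "(b, T + 1) \<in> set w"
  shows "\<exists>pre post. w = pre @ [(a, T)] @ window w T @ [(b, T + 1)] @ post"
proof -
  obtain pre rest where w: "w = pre @ (a, T) # rest"
    using assms(2) by (auto dest: split_list)
  have "(b, T + 1) \<in> set rest"
    using assms w by (auto simp: strictly_monotonic_append strictly_monotonic_Cons)
  then obtain mid post where rest: "rest = mid @ (b, T + 1) # post"
    by (auto dest: split_list)
  have mono: "strictly_monotonic (pre @ (a, T) # mid @ (b, T + 1) # post)"
    using assms(1) w rest by simp
  then have "filter (\<lambda>y. T < snd y \<and> snd y < T + 1) pre = []"
    "filter (\<lambda>y. T < snd y \<and> snd y < T + 1) mid = mid"
    "filter (\<lambda>y. T < snd y \<and> snd y < T + 1) post = []"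
    by (force simp: filter_empty_conv filter_id_conv strictly_monotonic_append strictly_monotonic_Cons)+
  then have "window w T = mid" by (simp add: window_def w rest)
  then show ?thesis using w rest by auto
qed

section \<open>Accepting runs\<close>

text \<open>Every edge leaving location \<open>4\<close> requires \<open>x = p\<close>, and the
  loops reset the clock, so each letter costs time \<open>p\<close>. Only \<open>Star\<close> leads
  to the final location, which has no outgoing edge; hence \<open>Star\<close> comes last.\<close>

lemma accepts_from_4:
  assumes "accepts_from (machine_automaton C s\<^sub>F) v 4 \<nu> t w" "\<nu> () = 0"
  shows "w \<noteq> [] \<and> last w = (Star, t + real (length w) * real_of_rat (v ())) \<and>
    fst ` set (butlast w) \<subseteq> message_letters C \<union> {Hash}"
  using assms
proof (induction w arbitrary: \<nu> t)
  case Nil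
  then show ?case by (simp add: machine_automaton_def)
next
  case (Cons y w)
  obtain a t' where y: "y = (a, t')" by (cases y)
  let ?p = "real_of_rat (v ())"
  obtain \<phi> r q where e: "(4, a, \<phi>, r, q) \<in> edges (machine_automaton C s\<^sub>F)"
    and sat: "satisfies v (\<lambda>x. \<nu> x + (t' - t)) \<phi>"
    and acc: "accepts_from (machine_automaton C s\<^sub>F) v q (\<lambda>x. if x \<in> r then 0 else \<nu> x + (t' - t)) t' w"
    using Cons.prems(1) y by auto
  from e consider "a \<in> message_letters C \<union> {Hash}" "\<phi> = clock_is_param" "r = {()}" "q = 4"
    | "a = Star" "\<phi> = clock_is_param" "q = 5"
    by (auto simp: machine_automaton_def)
  then show ?case
  proof cases
    case 1
    then have "t' = t + ?p" using sat Cons.prems(2) by (simp add: satisfies_def)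
    moreover have "w \<noteq> [] \<and> last w = (Star, t' + real (length w) * ?p) \<and>
        fst ` set (butlast w) \<subseteq> message_letters C \<union> {Hash}"
      using Cons.IH[of "\<lambda>x. if x \<in> r then 0 else \<nu> x + (t' - t)" t'] acc 1 by simp
    ultimately show ?thesis using 1(1) y by (simp add: distrib_right)
  next
    case 2
    then have "t' = t + ?p" using sat Cons.prems(2) by (simp add: satisfies_def)
    moreover have "w = []" using acc 2 by (cases w) (auto simp: machine_automaton_def)
    ultimately show ?thesis using 2 y by simp
  qed
qed

text \<open>The only way out of location \<open>3\<close> is the edge on \<open>s\<^sub>F\<close>,
  whose reset provides the clock value \<open>0\<close> from which the last interval is
  measured.\<close>

lemma accepts_from_3:
  assumes "accepts_from (machine_automaton C s\<^sub>F) v 3 \<nu> t w"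
  shows "\<exists>pre T post. w = pre @ (State s\<^sub>F, T) # post \<and>
    accepts_from (machine_automaton C s\<^sub>F) v 4 (\<lambda>_. 0) T post"
  using assms
proof (induction w arbitrary: \<nu> t)
  case Nil
  then show ?case by (simp add: machine_automaton_def)
next
  case (Cons y w)
  obtain a t' where y: "y = (a, t')" by (cases y)
  obtain \<phi> r q where e: "(3, a, \<phi>, r, q) \<in> edges (machine_automaton C s\<^sub>F)"
    and acc: "accepts_from (machine_automaton C s\<^sub>F) v q (\<lambda>x. if x \<in> r then 0 else \<nu> x + (t' - t)) t' w"
    using Cons.prems y by auto
  from e consider "q = 3" | "a = State s\<^sub>F" "r = {()}" "q = 4"
    by (auto simp: machine_automaton_def)
  then show ?case
  proof cases
    case 1
    then obtain pre T post where "w = pre @ (State s\<^sub>F, T) # post"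
      "accepts_from (machine_automaton C s\<^sub>F) v 4 (\<lambda>_. 0) T post"
      using Cons.IH acc by blast
    then show ?thesis by (intro exI[of _ "y # pre"]) auto
  next
    case 2
    then show ?thesis using y acc by (intro exI[of _ "[]"]) auto
  qed
qed

text \<open>The letters dictate the edges: \<open>Hash\<close> can only loop and an action can only
  leave. The \<open>n\<close> loops and the exit each cost time \<open>p\<close>, hence the factor
  \<open>n + 1\<close>.\<close>

lemma accepts_from_2:
  assumes "accepts_from (machine_automaton C s\<^sub>F) v 2 \<nu> t w" "\<nu> () = 0"
    and "map fst w = replicate n Hash @ Act l # rest"
  shows "snd (w ! n) = t + real (n + 1) * real_of_rat (v ()) \<and>
    (\<exists>\<nu>' t'. accepts_from (machine_automaton C s\<^sub>F) v 3 \<nu>' t' (drop (n + 1) w))"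
  using assms
proof (induction n arbitrary: \<nu> t w)
  case 0
  then obtain t' w' where w: "w = (Act l, t') # w'" by (cases w) auto
  obtain \<phi> r q where "(2, Act l, \<phi>, r, q) \<in> edges (machine_automaton C s\<^sub>F)"
    "satisfies v (\<lambda>x. \<nu> x + (t' - t)) \<phi>"
    "accepts_from (machine_automaton C s\<^sub>F) v q (\<lambda>x. if x \<in> r then 0 else \<nu> x + (t' - t)) t' w'"
    using 0(1) w by auto
  then show ?case using w 0(2) by (auto simp: machine_automaton_def satisfies_def)
next
  case (Suc n)
  then obtain t' w' where w: "w = (Hash, t') # w'" "map fst w' = replicate n Hash @ Act l # rest"
    by (cases w) auto
  obtain \<phi> r q where e: "(2, Hash, \<phi>, r, q) \<in> edges (machine_automaton C s\<^sub>F)"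
    and sat: "satisfies v (\<lambda>x. \<nu> x + (t' - t)) \<phi>"
    and acc: "accepts_from (machine_automaton C s\<^sub>F) v q (\<lambda>x. if x \<in> r then 0 else \<nu> x + (t' - t)) t' w'"
    using Suc.prems(1) w by auto
  have e': "\<phi> = clock_is_param" "r = {()}" "q = 2"
    using e by (auto simp: machine_automaton_def action_letters_def)
  have "t' = t + real_of_rat (v ())" using sat e' Suc.prems(2) by (simp add: satisfies_def)
  moreover have "snd (w' ! n) = t' + real (n + 1) * real_of_rat (v ()) \<and>
    (\<exists>\<nu>' t'. accepts_from (machine_automaton C s\<^sub>F) v 3 \<nu>' t' (drop (n + 1) w'))"
    using acc w(2) unfolding e' by (intro Suc.IH) auto
  ultimately show ?case using w(1) by (simp add: distrib_right)
qed

section \<open>Decoding a word\<close>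

text \<open>The outcome of those cases of \<open>copying\<close> that do not create an additional symbol.\<close>

fun copy_step :: "'m action \<Rightarrow> ('s, 'm) letter list \<Rightarrow> ('s, 'm) letter list \<Rightarrow> bool" where
  "copy_step EpsAct \<sigma> \<sigma>' \<longleftrightarrow> set \<sigma> \<subseteq> {Hash} \<and> \<sigma>' = \<sigma>"
| "copy_step (Send m) \<sigma> \<sigma>' \<longleftrightarrow>
    Hash \<in> set \<sigma> \<and> \<sigma>' = \<sigma>[(LEAST i. i < length \<sigma> \<and> \<sigma> ! i = Hash) := Msg m]"
| "copy_step (Recv m) \<sigma> \<sigma>' \<longleftrightarrow> (\<exists>\<tau>. \<sigma> = Msg m # \<tau> \<and> \<sigma>' = \<tau> @ [Hash])"

lemma length_copy_step: "copy_step l \<sigma> \<sigma>' \<Longrightarrow> length \<sigma>' = length \<sigma>"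
  by (cases l) auto

text \<open>The shape "messages, then padding" is preserved: a send replaces the first
  \<open>Hash\<close>, which sits right behind the messages; a receive removes the front message and
  lengthens the padding; the emptiness test forces \<open>x = []\<close>.\<close>

lemma copy_step_error_free:
  assumes "copy_step l (map Msg x @ replicate k Hash) \<sigma>'" "(s, l, s') \<in> transitions C"
  shows "\<exists>x' k'. \<sigma>' = map Msg x' @ replicate k' Hash \<and> error_free_step C (s, x) l (s', x')"
proof (cases l)
  case EpsAct
  then have "x = []" "\<sigma>' = replicate k Hash" using assms(1) by (cases x; auto)+
  then show ?thesis using assms(2) EpsAct error_free_step.eps
    by (intro exI[of _ "[]"] exI[of _ k]) auto
next
  case (Send m)
  \<comment> \<open>Without padding the content would offer no \<open>Hash\<close> to overwrite, so
    \<open>k\<close> is positive.\<close>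
  have "Hash \<notin> Msg ` set x" by auto
  then obtain k' where k: "k = Suc k'" using assms(1) Send by (cases k) auto
  have "(LEAST i. i < length (map Msg x @ replicate k Hash) \<and> (map Msg x @ replicate k Hash) ! i = Hash) = length x"
    by (rule Least_equality) (auto simp: k nth_append split: if_splits)
  then have "\<sigma>' = (map Msg x @ replicate k Hash)[length x := Msg m]"
    using assms(1) unfolding Send copy_step.simps by metis
  then have "\<sigma>' = map Msg (x @ [m]) @ replicate k' Hash"
    using k by (simp add: list_update_append)
  then show ?thesis using assms(2) Send error_free_step.send by fast
next
  case (Recv m)
  then obtain \<tau> where \<tau>: "map Msg x @ replicate k Hash = Msg m # \<tau>" "\<sigma>' = \<tau> @ [Hash]"
    using assms(1) by auto
  then obtain x' where x': "x = m # x'" by (cases x; cases k) auto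
  then have "\<sigma>' = map Msg x' @ replicate (Suc k) Hash"
    using \<tau> by (auto simp: replicate_append_same)
  then show ?thesis using assms(2) Recv x' error_free_step.recv by fast
qed

text \<open>Separates the cases by their effect on the number of symbols: \<open>insertion\<close>
  exhibits one more letter in the next window than the segment holds, while \<open>exact\<close>
  keeps the number and yields a legal change of the content.\<close>

lemma copying_cases:
  assumes "copying w t \<sigma> d l" "length \<sigma> = length d" "sorted_wrt (<) ([0] @ d @ [1])"
  obtains (insertion) ys where "strictly_monotonic ys" "set ys \<subseteq> set (window w (t + 2))"
      "length ys = Suc (length \<sigma>)"
  | (exact) \<sigma>' where "copy_step l \<sigma> \<sigma>'" "set (zip \<sigma>' (map (\<lambda>e. t + 2 + e) d)) \<subseteq> set w"
proof -
  have zip_subset: "set (zip \<tau> (map (\<lambda>e. t + 2 + e) d)) \<subseteq> set w"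
    if "\<And>i. i < length \<tau> \<Longrightarrow> (\<tau> ! i, t + 2 + d ! i) \<in> set w" "length \<tau> = length d" for \<tau>
    using that by (auto simp: set_zip)
  \<comment> \<open>Both failing cases, a send into a full content and a receive of a message not in
    front, demand copies of everything and one letter behind all of them. With an empty segment,
    \<open>last (0 # d)\<close> is \<open>0\<close>, and the new letter only has to lie inside the
    window.\<close>
  have extra: thesis
    if copies: "\<And>i. i < length \<sigma> \<Longrightarrow> (\<sigma> ! i, t + 2 + d ! i) \<in> set w"
      and u: "t + 2 + last (0 # d) < u" "u < t + 3" "(a, u) \<in> set w" for a u
  proof (rule insertion)
    let ?zs = "zip \<sigma> (map (\<lambda>e. t + 2 + e) d)"
    have snd: "map snd ?zs = map (\<lambda>e. t + 2 + e) d" using assms(2) by simp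
    have d: "sorted_wrt (<) d" "\<forall>e\<in>set d. 0 < e \<and> e < 1"
      using assms(3) by (auto simp: sorted_wrt_append)
    have "e \<le> last (0 # d)" if "e \<in> set d" for e
      using d(1) that by (cases d rule: rev_cases) (auto simp: sorted_wrt_append)
    then have *: "\<forall>e\<in>set d. t + 2 + e < u" using u(1) by fastforce
    show "strictly_monotonic (?zs @ [(a, u)])"
      unfolding strictly_monotonic_def map_append snd using d(1) *
      by (auto simp: sorted_wrt_append sorted_wrt_map)
    have "0 \<le> last (0 # d)" using d(2) by (cases d rule: rev_cases) auto
    moreover have "snd y \<in> set (map (\<lambda>e. t + 2 + e) d)" if "y \<in> set ?zs" for y
      using that snd by (metis image_eqI set_map)
    then have "t + 2 < snd y \<and> snd y < t + 3" if "y \<in> set ?zs" for y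
      using d(2) that by fastforce
    ultimately show "set (?zs @ [(a, u)]) \<subseteq> set (window w (t + 2))"
      using zip_subset[OF copies assms(2)] u
      unfolding set_append Un_subset_iff by (fastforce simp: in_window_iff subset_iff)
    show "length (?zs @ [(a, u)]) = Suc (length \<sigma>)" using assms(2) by simp
  qed
  show thesis
  proof (cases l)
    case EpsAct
    then have *: "\<sigma> ! i = Hash" "(\<sigma> ! i, t + 2 + d ! i) \<in> set w" if "i < length \<sigma>" for i
      using assms(1) that by auto
    show ?thesis
    proof (rule exact)
      show "copy_step l \<sigma> \<sigma>" using EpsAct *(1) by (auto simp: in_set_conv_nth)
    qed (rule zip_subset[OF *(2) assms(2)])
  next
    case (Send m)
    show ?thesis
    proof (cases "Hash \<in> set \<sigma>")
      case True
      define j where "j = (LEAST i. i < length \<sigma> \<and> \<sigma> ! i = Hash)"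
      have *: "(Msg m, t + 2 + d ! j) \<in> set w" "\<forall>k<length \<sigma>. k \<noteq> j \<longrightarrow> (\<sigma> ! k, t + 2 + d ! k) \<in> set w"
        using assms(1) Send True unfolding j_def by (auto simp: Let_def)
      show ?thesis
      proof (rule exact)
        show "copy_step l \<sigma> (\<sigma>[j := Msg m])" using Send True by (simp add: j_def)
        show "set (zip (\<sigma>[j := Msg m]) (map (\<lambda>e. t + 2 + e) d)) \<subseteq> set w"
        proof (rule zip_subset)
          show "(\<sigma>[j := Msg m] ! i, t + 2 + d ! i) \<in> set w" if "i < length (\<sigma>[j := Msg m])" for i
            using * that by (cases "i = j") simp_all
        qed (use assms(2) in simp)
      qed
    next
      case False
      then show ?thesis using assms(1) Send extra by auto
    qed
  next
    case (Recv m)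
    show ?thesis
    proof (cases "\<sigma> \<noteq> [] \<and> \<sigma> ! 0 = Msg m")
      case True
      then obtain \<tau> where \<tau>: "\<sigma> = Msg m # \<tau>" by (cases \<sigma>) auto
      have *: "\<forall>i. 1 \<le> i \<and> i < length \<sigma> \<longrightarrow> (\<sigma> ! i, t + 2 + d ! (i - 1)) \<in> set w"
        "(Hash, t + 2 + last (0 # d)) \<in> set w"
        using assms(1) Recv True by auto
      \<comment> \<open>Here \<open>d\<close> has one entry more than \<open>\<tau>\<close>, so the
        default \<open>0\<close> is not reached and the new \<open>Hash\<close> takes the last old
        offset.\<close>
      have "last (0 # d) = d ! length \<tau>" using assms(2) \<tau> by (cases d rule: rev_cases) (auto simp: nth_append)
      then have copies: "((\<tau> @ [Hash]) ! i, t + 2 + d ! i) \<in> set w" if "i < length (\<tau> @ [Hash])" for i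
        using *(1)[rule_format, of "Suc i"] *(2) that \<tau> by (cases "i = length \<tau>") (auto simp: nth_append)
      show ?thesis
      proof (rule exact)
        show "copy_step l \<sigma> (\<tau> @ [Hash])" using Recv \<tau> by simp
      qed (rule zip_subset[OF copies], use assms(2) \<tau> in simp_all)
    next
      case False
      then show ?thesis using assms(1) Recv extra by auto
    qed
  qed
qed

text \<open>The start time \<open>t\<^sub>0\<close> is left open, because the first edge of the
  automaton carries no constraint on it.\<close>

locale encoding_word =
  fixes C :: "('s, 'm) channel_machine" and s\<^sub>F :: 's and w :: "('s, 'm) letter timed_word" and t\<^sub>0 :: real
  assumes machine: "channel_machine C"
    and letters: "timed_word (alphabet C) w"
    and mono: "strictly_monotonic w"
    and control: "control_structure C s\<^sub>F w"
    and copied: "content_copied C s\<^sub>F w"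
    and first: "w ! 0 = (State (init_state C), t\<^sub>0)"
begin

lemma letter_unique: "(a, t) \<in> set w \<Longrightarrow> (b, t) \<in> set w \<Longrightarrow> a = b"
  using strictly_monotonic_letter_unique[OF mono] .

lemma first_in_word: "(State (init_state C), t\<^sub>0) \<in> set w"
  using first letters by (metis length_greater_0_conv nth_mem timed_word_def)

lemma time_less_imp_index_less:
  assumes "i < length w" "j < length w" "snd (w ! i) < snd (w ! j)"
  shows "i < j"
proof (rule ccontr)
  assume "\<not> i < j"
  then have "snd (w ! j) \<le> snd (w ! i)"
    using mono assms(1) unfolding strictly_monotonic_def sorted_wrt_map
    by (cases "i = j") (auto simp: sorted_wrt_iff_nth_less intro: less_imp_le)
  then show False using assms(3) by simp
qed

text \<open>The "nowhere else" clause leads from a state to another one two units earlier that is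
  not \<open>s\<^sub>F\<close>. Its index is smaller, so the chain ends at the first letter; it
  visits every intermediate time, which later supplies all states of the computation.\<close>

lemma state_time:
  assumes "(State q, u) \<in> set w"
  shows "\<exists>i. u = t\<^sub>0 + 2 * real i \<and> (\<forall>j<i. \<exists>q'. q' \<noteq> s\<^sub>F \<and> (State q', t\<^sub>0 + 2 * real j) \<in> set w)"
proof -
  obtain k where "k < length w" "w ! k = (State q, u)"
    using assms by (auto simp: in_set_conv_nth)
  then show ?thesis
  proof (induction k arbitrary: q u rule: less_induct)
    case (less k)
    show ?case
    proof (cases "k = 0")
      case True
      then show ?thesis using less.prems first by (intro exI[of _ 0]) auto
    next
      case False
      then obtain q' t where q': "(State q', t) \<in> set w" "q' \<noteq> s\<^sub>F" "u = t + 2"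
        using less.prems control unfolding control_structure_def by blast
      then obtain k' where k': "k' < length w" "w ! k' = (State q', t)"
        by (auto simp: in_set_conv_nth)
      then have "k' < k" using time_less_imp_index_less[of k' k] less.prems q'(3) by simp
      then obtain i where i: "t = t\<^sub>0 + 2 * real i"
        "\<forall>j<i. \<exists>q'. q' \<noteq> s\<^sub>F \<and> (State q', t\<^sub>0 + 2 * real j) \<in> set w"
        using less.IH k' by blast
      then show ?thesis using q' by (intro exI[of _ "Suc i"]) (auto simp: less_Suc_eq)
    qed
  qed
qed

text \<open>Relative to \<open>t\<^sub>0\<close>, states occur at even integers, actions and
  \<open>Star\<close> at odd ones; the open unit interval contains no integer offset.\<close>

lemma window_content:
  assumes "y \<in> set (window w (t\<^sub>0 + 2 * real i))"
  shows "fst y \<in> message_letters C \<union> {Hash}"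
proof -
  obtain a u where y: "y = (a, u)" by (cases y)
  have u: "(a, u) \<in> set w" "t\<^sub>0 + 2 * real i < u" "u < t\<^sub>0 + 2 * real i + 1"
    using assms y by (auto simp: in_window_iff)
  have no_state: False if "(State q, t) \<in> set w" "u = t \<or> u = t + 1" for q t
  proof -
    obtain j where "t = t\<^sub>0 + 2 * real j" using state_time[OF \<open>(State q, t) \<in> set w\<close>] by blast
    then have "2 * real i < 2 * real j + 1" "2 * real j < 2 * real i + 1" "i \<noteq> j" using u that(2) by auto
    then show False by linarith
  qed
  have "a \<noteq> State q" "a \<noteq> Act l" "a \<noteq> Star" for q l
    using no_state control u(1) unfolding control_structure_def by blast+
  moreover have "a \<in> alphabet C" using u(1) letters by (force simp: timed_word_def)
  ultimately show ?thesis using y by (auto simp: alphabet_def state_letters_def action_letters_def)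
qed

text \<open>A state other than \<open>s\<^sub>F\<close> forces an action and a next state, and
  \<open>copying\<close> bounds the next window from below. Equality of the two lengths rules out
  the case \<open>insertion\<close>.\<close>

lemma successor:
  assumes state: "(State q, t\<^sub>0 + 2 * real i) \<in> set w" "q \<noteq> s\<^sub>F"
  defines "W \<equiv> \<lambda>i. window w (t\<^sub>0 + 2 * real i)"
  obtains l q' where "(q, l, q') \<in> transitions C" "(State q', t\<^sub>0 + 2 * real (Suc i)) \<in> set w"
    "length (W i) \<le> length (W (Suc i))"
    "length (W i) = length (W (Suc i)) \<Longrightarrow> copy_step l (map fst (W i)) (map fst (W (Suc i)))"
proof -
  define t where "t = t\<^sub>0 + 2 * real i"
  have Suc: "t\<^sub>0 + 2 * real (Suc i) = t + 2" unfolding t_def by simp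
  have W: "W i = window w t" "W (Suc i) = window w (t + 2)"
    by (simp_all only: W_def t_def Suc)
  obtain l q' where l: "(q, l, q') \<in> transitions C" "(Act l, t + 1) \<in> set w" "(State q', t + 2) \<in> set w"
    using control state unfolding control_structure_def t_def by blast
  obtain pre post where w: "w = pre @ [(State q, t)] @ W i @ [(Act l, t + 1)] @ post"
    using window_decomposition[OF mono _ l(2)] state(1) unfolding W t_def by blast
  define \<sigma> d where "\<sigma> = map fst (W i)" and "d = map (\<lambda>y. snd y - t) (W i)"
  have "zip \<sigma> (map (\<lambda>e. t + e) d) = W i"
    by (simp add: \<sigma>_def d_def comp_def zip_map_fst_snd)
  moreover have "q \<in> states C" "l \<in> actions (messages C)"
    using machine l(1) by (auto simp: channel_machine_def)
  moreover have "set \<sigma> \<subseteq> message_letters C \<union> {Hash}"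
    using window_content by (auto simp: \<sigma>_def W_def)
  moreover have sorted: "sorted_wrt (<) ([0] @ d @ [1])"
    using strictly_monotonic_window[OF mono, of t]
    by (auto simp: d_def W in_window_iff sorted_wrt_append sorted_wrt_map strictly_monotonic_def)
  moreover have len: "length \<sigma> = length d" by (simp add: \<sigma>_def d_def)
  ultimately have "copying w t \<sigma> d l"
    using copied w state(2) unfolding content_copied_def by (metis DiffI singletonD)
  then have "length (W i) \<le> length (W (Suc i)) \<and>
    (length (W i) = length (W (Suc i)) \<longrightarrow> copy_step l (map fst (W i)) (map fst (W (Suc i))))"
    using len sorted
  proof (cases rule: copying_cases)
    case (insertion ys)
    then have "card (set ys) \<le> card (set (window w (t + 2)))" by (intro card_mono) auto
    then have "Suc (length (W i)) \<le> length (W (Suc i))"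
      using insertion strictly_monotonic_distinct[OF insertion(1)]
        strictly_monotonic_distinct[OF strictly_monotonic_window[OF mono, of "t + 2"]]
      by (simp add: distinct_card W \<sigma>_def)
    then show ?thesis by simp
  next
    case (exact \<sigma>')
    \<comment> \<open>These are the letters that the segment prescribes for the next window. They
      lie in it and are as many as the letters of the old one, so equal lengths leave room for no
      others.\<close>
    define ys where "ys = zip \<sigma>' (map (\<lambda>e. t + 2 + e) d)"
    have len': "length \<sigma>' = length d" using length_copy_step[OF exact(1)] len by simp
    have fst: "map fst ys = \<sigma>'" and snd: "map snd ys = map (\<lambda>e. t + 2 + e) d"
      using len' by (simp_all add: ys_def)
    have ys: "strictly_monotonic ys"
      using sorted unfolding strictly_monotonic_def snd by (auto simp: sorted_wrt_append sorted_wrt_map)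
    have "t + 2 < snd y \<and> snd y < t + 2 + 1" if "y \<in> set ys" for y
    proof -
      have "snd y \<in> set (map (\<lambda>e. t + 2 + e) d)" using that snd by (metis image_eqI set_map)
      then show ?thesis using sorted by (auto simp: sorted_wrt_append)
    qed
    then have sub: "set ys \<subseteq> set (W (Suc i))" using exact(2) by (auto simp: in_window_iff W ys_def)
    have W': "strictly_monotonic (W (Suc i))" using strictly_monotonic_window[OF mono] W by simp
    have "length ys = length (W i)" using len' by (simp add: ys_def d_def)
    moreover have "length ys \<le> length (W (Suc i))"
      using card_mono[OF _ sub] strictly_monotonic_distinct[OF ys] strictly_monotonic_distinct[OF W']
      by (simp add: distinct_card)
    moreover have "ys = W (Suc i)" if "length ys = length (W (Suc i))"
      using strictly_monotonic_eqI[OF ys W' sub that] .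
    ultimately show ?thesis using exact(1) fst \<sigma>_def by auto
  qed
  then show thesis using that l Suc by metis
qed

lemma computation:
  assumes final: "(State s\<^sub>F, t\<^sub>0 + 2 * real N) \<in> set w"
    and states: "\<And>j. j < N \<Longrightarrow> \<exists>q. q \<noteq> s\<^sub>F \<and> (State q, t\<^sub>0 + 2 * real j) \<in> set w"
    and start: "map fst (window w t\<^sub>0) = replicate n Hash"
    and final_length: "length (window w (t\<^sub>0 + 2 * real N)) = n"
  shows "\<exists>x. error_free_computation C (init_state C, []) (s\<^sub>F, x)"
proof -
  define W where "W i = window w (t\<^sub>0 + 2 * real i)" for i
  have "length (W 0) = n" using arg_cong[OF start, of length] by (simp add: W_def)
  have incr: "length (W i) \<le> length (W (Suc i))" if "i < N" for i
    using states[OF that] successor unfolding W_def by metis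
  have lower: "n \<le> length (W i)" if "i \<le> N" for i
    using that
  proof (induction i)
    case 0
    then show ?case using \<open>length (W 0) = n\<close> by simp
  next
    case (Suc i)
    then show ?case using incr[of i] by simp
  qed
  have upper: "length (W i) \<le> n" if "i \<le> N" for i
    using that
  proof (induction i rule: inc_induct)
    case base
    then show ?case using final_length by (simp add: W_def)
  next
    case (step i)
    then show ?case using incr[of i] by simp
  qed
  have len: "length (W i) = n" if "i \<le> N" for i using lower upper that by (simp add: le_antisym)
  \<comment> \<open>The shape of the window is part of the induction: it makes the channel content
    \<open>x\<close> readable, and legal copy steps preserve it. It starts with
    \<open>x = []\<close> and \<open>k = n\<close>.\<close>
  have "\<exists>q x k. (State q, t\<^sub>0 + 2 * real i) \<in> set w \<and> map fst (W i) = map Msg x @ replicate k Hash \<and>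
      error_free_computation C (init_state C, []) (q, x)" if "i \<le> N" for i
    using that
  proof (induction i)
    case 0
    show ?case
      using first_in_word start
      by (intro exI[of _ "init_state C"] exI[of _ "[]"] exI[of _ n]) (simp add: W_def error_free_computation_def)
  next
    case (Suc i)
    then obtain q x k where q: "(State q, t\<^sub>0 + 2 * real i) \<in> set w"
      and x: "map fst (W i) = map Msg x @ replicate k Hash"
      and comp: "error_free_computation C (init_state C, []) (q, x)" by auto
    have "q \<noteq> s\<^sub>F" using states[of i] Suc.prems q letter_unique by fastforce
    with q obtain l q' where l: "(q, l, q') \<in> transitions C" "(State q', t\<^sub>0 + 2 * real (Suc i)) \<in> set w"
      "copy_step l (map fst (W i)) (map fst (W (Suc i)))"
      using successor[of q i] len[of i] len[of "Suc i"] Suc.prems unfolding W_def by (metis Suc_leD)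
    then obtain x' k' where x': "map fst (W (Suc i)) = map Msg x' @ replicate k' Hash"
      "error_free_step C (q, x) l (q', x')"
      using copy_step_error_free x by metis
    then have "error_free_computation C (init_state C, []) (q', x')"
      using comp unfolding error_free_computation_def by (metis (mono_tags, lifting) rtranclp.rtrancl_into_rtrancl)
    then show ?case using l(2) x' by blast
  qed
  from this[of N] show ?thesis using final letter_unique by blast
qed

end

section \<open>From an accepted encoding to a computation\<close>

lemma error_free_computation_messages:
  assumes "channel_machine C" "error_free_computation C (s, x) (s', x')" "x \<in> lists (messages C)"
  shows "x' \<in> lists (messages C)"
  using assms(2,3) unfolding error_free_computation_def
proof (induction rule: rtranclp_induct2)
  case (step s1 x1 s2 x2)
  then obtain a where "error_free_step C (s1, x1) a (s2, x2)" by blast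
  then show ?case using step.IH step.prems assms(1)
    by (cases rule: error_free_step.cases) (auto simp: channel_machine_def actions_def)
qed

lemma encoding_imp_computation:
  assumes machine: "channel_machine C"
    and w: "w \<in> encoding_language C s\<^sub>F n" "w \<in> pta_language v (machine_automaton C s\<^sub>F)"
  shows "\<exists>x. error_free_computation C (init_state C, []) (s\<^sub>F, x)"
proof -
  let ?p = "real_of_rat (v ())"
  obtain l s rest where word: "map fst w = [State (init_state C)] @ replicate n Hash @ [Act l, State s] @ rest"
    and facts: "timed_word (alphabet C) w" "strictly_monotonic w" "control_structure C s\<^sub>F w"
      "content_copied C s\<^sub>F w"
    using w(1) unfolding encoding_language_def by blast
  obtain t\<^sub>0 w' where w': "w = (State (init_state C), t\<^sub>0) # w'"
    "map fst w' = replicate n Hash @ Act l # State s # rest"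
    using word by (cases w) auto
  interpret encoding_word C s\<^sub>F w t\<^sub>0
    using machine facts w' by unfold_locales auto
  have "accepts_from (machine_automaton C s\<^sub>F) v 1 (\<lambda>_. 0) 0 w"
    using w(2) by (simp add: pta_language_def machine_automaton_def)
  then have "accepts_from (machine_automaton C s\<^sub>F) v 2 (\<lambda>_. 0) t\<^sub>0 w'"
    unfolding w' by (auto simp: machine_automaton_def action_letters_def)
  from accepts_from_2[OF this _ w'(2)] obtain \<nu> t
    where tn: "snd (w' ! n) = t\<^sub>0 + real (n + 1) * ?p"
      and acc: "accepts_from (machine_automaton C s\<^sub>F) v 3 \<nu> t (drop (n + 1) w')" by auto
  obtain pre T post where split: "drop (n + 1) w' = pre @ (State s\<^sub>F, T) # post"
    and acc4: "accepts_from (machine_automaton C s\<^sub>F) v 4 (\<lambda>_. 0) T post"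
    using accepts_from_3[OF acc] by blast
  from accepts_from_4[OF acc4] have post: "post \<noteq> []" "last post = (Star, T + real (length post) * ?p)"
    "fst ` set (butlast post) \<subseteq> message_letters C \<union> {Hash}" by auto
  have len: "length w' = n + 2 + length rest" using arg_cong[OF w'(2), of length] by simp
  define hs where "hs = take n w'"
  have hs: "map fst hs = replicate n Hash" using w'(2) by (simp add: hs_def take_map[symmetric])
  have "fst (w' ! n) = Act l" using arg_cong[OF w'(2), of "\<lambda>xs. xs ! n"] len by (simp add: nth_append)
  then have wn: "w' ! n = (Act l, t\<^sub>0 + real (n + 1) * ?p)" using tn by (metis prod.collapse)
  then have w_split: "w = (State (init_state C), t\<^sub>0) # hs @ (Act l, t\<^sub>0 + real (n + 1) * ?p) # drop (n + 1) w'"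
    using w'(1) len id_take_nth_drop[of n w'] by (simp add: hs_def)
  have mono_split: "strictly_monotonic ((State (init_state C), t\<^sub>0) # hs @ (Act l, t\<^sub>0 + real (n + 1) * ?p) # drop (n + 1) w')"
    using facts(2) w_split by simp
  have "(Act l, t\<^sub>0 + real (n + 1) * ?p) \<in> set w" by (subst w_split) simp
  then obtain q u where q: "(State q, u) \<in> set w" "t\<^sub>0 + real (n + 1) * ?p = u + 1"
    using facts(3) unfolding control_structure_def by blast
  \<comment> \<open>The action needs a state one unit earlier. Before the action there are only the
    first letter and copies of \<open>Hash\<close>, so that state is the first letter, and
    \<open>n + 1\<close> periods of length \<open>p\<close> make up one time unit.\<close>
  have "(State q, u) \<notin> set hs" using hs by (metis fst_conv image_eqI in_set_replicate letter.distinct(5) set_map)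
  moreover have "(State q, u) \<in> set ((State (init_state C), t\<^sub>0) # hs @ (Act l, t\<^sub>0 + real (n + 1) * ?p) # drop (n + 1) w')"
    using q(1) w_split by metis
  ultimately have "u = t\<^sub>0"
    using mono_split q(2) by (auto simp: strictly_monotonic_Cons strictly_monotonic_append)
  then have p: "real (n + 1) * ?p = 1" using q(2) by simp
  have "window w t\<^sub>0 = hs"
  proof -
    have "filter (\<lambda>y. t\<^sub>0 < snd y \<and> snd y < t\<^sub>0 + 1) hs = hs"
      "filter (\<lambda>y. t\<^sub>0 < snd y \<and> snd y < t\<^sub>0 + 1) (drop (n + 1) w') = []"
      using mono_split unfolding p
      by (force simp: filter_empty_conv filter_id_conv strictly_monotonic_append strictly_monotonic_Cons)+
    then show ?thesis unfolding window_def by (subst w_split) (simp add: p[simplified])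
  qed
  then have start: "map fst (window w t\<^sub>0) = replicate n Hash" using hs by simp
  define pre' where "pre' = (State (init_state C), t\<^sub>0) # hs @ (Act l, t\<^sub>0 + real (n + 1) * ?p) # pre"
  have w_split': "w = pre' @ (State s\<^sub>F, T) # butlast post @ [(Star, T + real (length post) * ?p)]"
    using w_split split post by (simp add: pre'_def) (metis append_butlast_last_id)
  then have mono_split': "strictly_monotonic (pre' @ (State s\<^sub>F, T) # butlast post @ [(Star, T + real (length post) * ?p)])"
    using facts(2) by metis
  have "(State s\<^sub>F, T) \<in> set w" by (subst w_split') simp
  then obtain N where N: "T = t\<^sub>0 + 2 * real N"
    "\<forall>j<N. \<exists>q. q \<noteq> s\<^sub>F \<and> (State q, t\<^sub>0 + 2 * real j) \<in> set w"
    using state_time by blast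
  have "(Star, T + 1) \<in> set w" using facts(3) \<open>(State s\<^sub>F, T) \<in> set w\<close> unfolding control_structure_def by blast
  then have "(Star, T + 1) \<in> set (pre' @ (State s\<^sub>F, T) # butlast post @ [(Star, T + real (length post) * ?p)])"
    using w_split' by metis
  \<comment> \<open>The \<open>Star\<close> required at \<open>T + 1\<close> is neither among the
    content letters nor in the part before \<open>T\<close>, so it is the last letter of the
    word.\<close>
  moreover have "(Star, T + 1) \<notin> set (butlast post)"
    using post(3) by (auto simp: message_letters_def)
  ultimately have end_time: "real (length post) * ?p = 1"
    using mono_split' by (auto simp: strictly_monotonic_Cons strictly_monotonic_append)
  have "window w T = butlast post"
  proof -
    have "filter (\<lambda>y. T < snd y \<and> snd y < T + 1) pre' = []"
      "filter (\<lambda>y. T < snd y \<and> snd y < T + 1) (butlast post) = butlast post"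
      using mono_split' unfolding end_time
      by (force simp: filter_empty_conv filter_id_conv strictly_monotonic_append strictly_monotonic_Cons)+
    then show ?thesis unfolding window_def by (subst w_split') (simp add: end_time)
  qed
  \<comment> \<open>Both lengths multiplied by \<open>p\<close> give \<open>1\<close>, so
    \<open>p\<close> is nonzero and cancels; dropping the final \<open>Star\<close> leaves
    \<open>n\<close> symbols.\<close>
  moreover have "length post = n + 1"
    using p end_time by (metis mult_cancel_right mult_zero_right of_nat_eq_iff zero_neq_one)
  ultimately have "length (window w (t\<^sub>0 + 2 * real N)) = n" using N(1) by simp
  then show ?thesis
    using computation[OF _ _ start] \<open>(State s\<^sub>F, T) \<in> set w\<close> N by blast
qed


theorem theorem5:
  fixes C :: "('s, 'm) channel_machine" and s\<^sub>F :: 's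
  assumes "channel_machine C" and "s\<^sub>F \<in> states C" and "s\<^sub>F \<noteq> init_state C"
  shows "(\<exists>x \<in> lists (messages C). error_free_computation C (init_state C, []) (s\<^sub>F, x)) \<longleftrightarrow>
    (\<exists>n v. parameter_valuation (machine_automaton C s\<^sub>F) v \<and>
       encoding_language C s\<^sub>F n \<inter> pta_language v (machine_automaton C s\<^sub>F) \<noteq> {})"
proof
  assume "\<exists>x \<in> lists (messages C). error_free_computation C (init_state C, []) (s\<^sub>F, x)"
  then obtain x where "error_free_computation C (init_state C, []) (s\<^sub>F, x)" ..
  then show "\<exists>n v. parameter_valuation (machine_automaton C s\<^sub>F) v \<and>
       encoding_language C s\<^sub>F n \<inter> pta_language v (machine_automaton C s\<^sub>F) \<noteq> {}"
    by (rule computation_imp_encoding[OF assms(1,3)])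
next
  assume "\<exists>n v. parameter_valuation (machine_automaton C s\<^sub>F) v \<and>
       encoding_language C s\<^sub>F n \<inter> pta_language v (machine_automaton C s\<^sub>F) \<noteq> {}"
  then obtain x where x: "error_free_computation C (init_state C, []) (s\<^sub>F, x)"
    using encoding_imp_computation[OF assms(1)] by blast
  then have "x \<in> lists (messages C)"
    using error_free_computation_messages[OF assms(1) x] by simp
  with x show "\<exists>x \<in> lists (messages C). error_free_computation C (init_state C, []) (s\<^sub>F, x)" by blast
qed

end
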